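(* Let $d\ge1$ and $K\ge2$ be integers. Given any $\mathbb{A}=(\mathbb{A}_{ij})\in\{0,1\}^{K\times K}$, the function $$\boldsymbol{A}=(A_1,\dots,A_K)\ \mapsto\ \boldsymbol{\rho}(\boldsymbol{A},\mathbb{A})=\limsup_{n\to\infty}\ \max_{w\in W_{\mathrm{per}}^n(\mathbb{A})}\sqrt[n]{\rho(A_{w_n}\cdots A_{w_1})}$$ is continuous on the space $\mathrm{C}(\{1,\dots,K\},\mathbb{R}^{d\times d})=(\mathbb{R}^{d\times d})^K$ of ordered $K$-tuples of real $d\times d$ matrices.
   Context: $\rho(B)$ is the spectral radius of a matrix $B$. For $n\ge1$, $W_{\mathrm{per}}^n(\mathbb{A})$ is the set of words $w=(w_1,\dots,w_n)\in\{1,\dots,K\}^n$ with $\mathbb{A}_{w_kw_{k+1}}=1$ for $1\le k<n$ and $\mathbb{A}_{w_nw_1}=1$. A maximum over an empty set is taken to be $0$. The space $(\mathbb{R}^{d\times d})^K$ has its usual topology. *)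

theory Defs
  imports "HOL-Analysis.Analysis"
begin

text \<open>
  The dimension \<open>d\<close> and the alphabet \<open>{1,\<dots>,K}\<close> are finite index types \<open>'d\<close> and \<open>'k\<close>
  with \<open>d = CARD('d)\<close> and \<open>K = CARD('k)\<close>. The type \<open>(real^'d^'d)^'k\<close> of \<open>K\<close>-tuples of
  real \<open>d \<times> d\<close> matrices carries the product topology.
\<close>

definition complex_eigenvalues :: "real^'d^'d \<Rightarrow> complex set" where
  "complex_eigenvalues B =
     {\<mu>. \<exists>v :: complex^'d. v \<noteq> 0 \<and> map_matrix complex_of_real B *v v = \<mu> *s v}"

definition matrix_spectral_radius :: "real^'d^'d \<Rightarrow> real" where
  "matrix_spectral_radius B = Max (cmod ` complex_eigenvalues B)"

text \<open>
  A word \<open>(w\<^sub>1,\<dots>,w\<^sub>n)\<close> is the list \<open>[w\<^sub>1,\<dots>,w\<^sub>n]\<close>, so \<open>w\<^sub>k\<close> is \<open>w ! (k - 1)\<close>.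
  Only \<open>n \<ge> 1\<close> is meaningful.
\<close>

definition periodic_words :: "nat^'k^'k \<Rightarrow> nat \<Rightarrow> 'k list set" where
  "periodic_words T n =
     {w. length w = n \<and> (\<forall>k. Suc k < n \<longrightarrow> T $ (w ! k) $ (w ! Suc k) = 1) \<and>
         T $ (w ! (n - 1)) $ (w ! 0) = 1}"

text \<open>\<open>word_product A [w\<^sub>1,\<dots>,w\<^sub>n]\<close> is \<open>A\<^bsub>w\<^sub>n\<^esub> \<cdots> A\<^bsub>w\<^sub>1\<^esub>\<close>: the first letter acts first.\<close>

primrec word_product :: "(real^'d^'d)^'k \<Rightarrow> 'k list \<Rightarrow> real^'d^'d" where
  "word_product A [] = mat 1"
| "word_product A (i # w) = word_product A w ** (A $ i)"

definition max_periodic_radius :: "(real^'d^'d)^'k \<Rightarrow> nat^'k^'k \<Rightarrow> nat \<Rightarrow> real" where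
  "max_periodic_radius A T n =
     (if periodic_words T n = {} then 0
      else Max ((\<lambda>w. root n (matrix_spectral_radius (word_product A w))) ` periodic_words T n))"

text \<open>
  The upper limit is taken in the extended reals. It is finite: if \<open>C\<close> bounds the operator
  norms of all \<open>A $ i\<close>, the terms with \<open>n \<ge> 1\<close> lie between \<open>0\<close> and \<open>C\<close>. The term with
  \<open>n = 0\<close> does not influence the upper limit.
\<close>

definition constrained_spectral_radius :: "(real^'d^'d)^'k \<Rightarrow> nat^'k^'k \<Rightarrow> real" where
  "constrained_spectral_radius A T =
     real_of_ereal (limsup (\<lambda>n. ereal (max_periodic_radius A T n)))"

end

theory Submission
  imports Defs "HOL-Computational_Algebra.Fundamental_Theorem_Algebra"
begin

text \<open>
  Lower semicontinuity holds since the upper limit is also the supremum over all periodic words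
  (powers of a periodic word are periodic), and the spectral radius of a single product is lower
  semicontinuous. Upper semicontinuity follows from a Berger--Wang theorem: if
  \<open>\<rho>(A, T) < s\<close>, then the norms of the products along all admissible words of length \<open>n\<close> are at
  most \<open>C s\<^sup>n\<close>, and for a fixed large \<open>n\<close> such a bound is stable under perturbation.

  For the Berger--Wang theorem, scale the matrices so that the joint growth rate is \<open>1\<close>. A limit of
  normalised weighted orbit suprema is a nonzero family of seminorms \<open>N\<^sub>i\<close>, indexed by the last
  letter, with \<open>N\<^sub>i x = max N\<^sub>j (A\<^sub>j x)\<close> over the letters \<open>j\<close> that may follow \<open>i\<close>. Along a path
  that keeps the seminorm constant, compactness modulo the kernel yields two almost equal vectors
  with the same letter, hence a periodic word whose product has an approximate eigenvector with
  eigenvalue \<open>1\<close>. An annihilating product of factors \<open>M - \<mu>\<close> over eigenvalues \<open>\<mu>\<close> then shows that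
  some eigenvalue is close to \<open>1\<close>. No reduction to irreducible families is needed, because the
  seminorms may be degenerate.
\<close>

section \<open>Eigenvalues of complex matrices\<close>

definition eigenvalues :: "complex^'n^'n \<Rightarrow> complex set" where
  "eigenvalues M = {\<mu>. \<exists>v. v \<noteq> 0 \<and> M *v v = \<mu> *s v}"

text \<open>The product of the factors \<open>M - z\<close> is encoded as a map on vectors, so that
  an estimate in a seminorm can peel off one factor at a time.\<close>

primrec shifted_product :: "complex^'n^'n \<Rightarrow> complex list \<Rightarrow> complex^'n \<Rightarrow> complex^'n" where
  "shifted_product M [] x = x"
| "shifted_product M (z # zs) x = shifted_product M zs (M *v x - z *s x)"

text \<open>All factors are polynomials in \<open>M\<close> and hence commute; this moves a chosen
  factor from the first position to the last.\<close>

lemma shifted_product_commute: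
  "shifted_product M zs (M *v x - z *s x) = M *v shifted_product M zs x - z *s shifted_product M zs x"
proof (induction zs arbitrary: x)
  case (Cons a zs)
  have "M *v (M *v x - z *s x) - a *s (M *v x - z *s x) = M *v (M *v x - a *s x) - z *s (M *v x - a *s x)"
    by (simp add: matrix_vector_mult_diff_distrib vec.scale_right_diff_distrib vector_scalar_commute
        mult.commute)
  then show ?case by (simp only: shifted_product.simps Cons)
qed simp

section \<open>Polynomials in a matrix and their linear factors\<close>

definition poly_apply :: "complex poly \<Rightarrow> complex^'n^'n \<Rightarrow> complex^'n \<Rightarrow> complex^'n" where
  "poly_apply p M x = (\<Sum>i\<le>degree p. coeff p i *s (((*v) M) ^^ i) x)"

lemma poly_apply_linear_mult:
  assumes "q \<noteq> 0"
  shows "poly_apply ([:-z, 1:] * q) M x = poly_apply q M (M *v x - z *s x)"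
proof -
  define P where "P i = (((*v) M) ^^ i)" for i
  have lin: "P i (M *v x - z *s x) = P (Suc i) x - z *s P i x" for i
  proof (induction i)
    case (Suc i)
    have "P (Suc i) (M *v x - z *s x) = M *v P i (M *v x - z *s x)" by (simp add: P_def)
    also have "\<dots> = M *v (P (Suc i) x - z *s P i x)" using Suc by simp
    also have "\<dots> = P (Suc (Suc i)) x - z *s P (Suc i) x"
      by (simp add: P_def matrix_vector_mult_diff_distrib vector_scalar_commute)
    finally show ?case .
  qed (simp add: P_def)
  have deg: "degree ([:-z, 1:] * q) = Suc (degree q)"
    using assms by (subst degree_mult_eq) auto
  let ?d = "degree q"
  have 1: "(\<Sum>i\<le>Suc ?d. coeff q i *s P i x) = (\<Sum>i\<le>?d. coeff q i *s P i x)"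
    by (simp add: coeff_eq_0)
  have 2: "coeff ([:-z, 1:] * q) i = (case i of 0 \<Rightarrow> 0 | Suc j \<Rightarrow> coeff q j) - z * coeff q i" for i
    by (cases i) (auto simp: algebra_simps)
  have "poly_apply ([:-z, 1:] * q) M x =
     (\<Sum>i\<le>Suc ?d. (case i of 0 \<Rightarrow> 0 | Suc j \<Rightarrow> coeff q j) *s P i x - z *s (coeff q i *s P i x))"
    unfolding poly_apply_def deg 2 P_def by (simp add: vec.scale_left_diff_distrib)
  also have "\<dots> = (\<Sum>i\<le>Suc ?d. (case i of 0 \<Rightarrow> 0 | Suc j \<Rightarrow> coeff q j) *s P i x)
       - z *s (\<Sum>i\<le>Suc ?d. coeff q i *s P i x)"
    by (simp only: sum_subtractf vec.scale_sum_right)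
  also have "\<dots> = (\<Sum>i\<le>?d. coeff q i *s P (Suc i) x) - z *s (\<Sum>i\<le>?d. coeff q i *s P i x)"
    unfolding 1 by (subst sum.atMost_Suc_shift) simp
  also have "\<dots> = (\<Sum>i\<le>?d. coeff q i *s (P (Suc i) x - z *s P i x))"
    by (simp add: sum_subtractf vec.scale_sum_right vec.scale_right_diff_distrib mult.commute)
  also have "\<dots> = poly_apply q M (M *v x - z *s x)"
    by (simp only: poly_apply_def lin[symmetric]) (simp only: P_def)
  finally show ?thesis .
qed

text \<open>Over the complex numbers \<open>p\<close> splits into linear factors, split off one root
  at a time; \<open>c\<close> arises as the leading coefficient.\<close>

lemma poly_apply_eq_shifted_product:
  assumes "p \<noteq> 0"
  shows "\<exists>c zs. c \<noteq> 0 \<and> length zs = degree p \<and>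
           (\<forall>x. poly_apply p M x = c *s shifted_product M zs x)"
  using assms
proof (induction "degree p" arbitrary: p)
  case 0
  then obtain c where "p = [:c:]" "c \<noteq> 0" by (metis degree_eq_zeroE pCons_0_0)
  then show ?case by (intro exI[of _ c] exI[of _ "[]"]) (auto simp: poly_apply_def)
next
  case (Suc n)
  then have "\<not> constant (poly p)" by (simp add: constant_degree)
  then obtain z where "poly p z = 0" using fundamental_theorem_of_algebra by blast
  then obtain q where q: "p = [:-z, 1:] * q" by (meson poly_eq_0_iff_dvd dvdE)
  with Suc.prems have "q \<noteq> 0" by auto
  then have "degree p = Suc (degree q)" unfolding q by (subst degree_mult_eq) auto
  then have "n = degree q" using Suc.hyps by simp
  from Suc.hyps(1)[OF this \<open>q \<noteq> 0\<close>] obtain c zs where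
    "c \<noteq> 0" "length zs = degree q" "\<forall>x. poly_apply q M x = c *s shifted_product M zs x" by blast
  then show ?case
    using poly_apply_linear_mult[OF \<open>q \<noteq> 0\<close>, of z M] \<open>degree p = Suc (degree q)\<close>
    by (intro exI[of _ c] exI[of _ "z # zs"]) (auto simp: q)
qed

text \<open>The powers of \<open>M\<close> with exponents 0 to D lie in a real space of dimension D,
  so they satisfy a linear relation. The degree bound is cruder than that of Cayley-Hamilton, but it
  is uniform in \<open>M\<close>.\<close>

lemma annihilating_poly:
  fixes M :: "complex^'n^'n"
  shows "\<exists>p. p \<noteq> 0 \<and> degree p \<le> DIM(complex^'n^'n) \<and> (\<forall>x. poly_apply p M x = 0)"
proof -
  define D where "D = DIM(complex^'n^'n)"
  define P where "P i = (((**) M) ^^ i) (mat 1)" for i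
  have P: "P i *v x = (((*v) M) ^^ i) x" for i x
    by (induction i) (auto simp: P_def simp flip: matrix_vector_mul_assoc)
  have "\<exists>u :: nat \<Rightarrow> real. (\<exists>i\<le>D. u i \<noteq> 0) \<and> (\<Sum>i\<le>D. u i *\<^sub>R P i) = 0"
  proof (cases "inj_on P {..D}")
    case True
    have "dependent (P ` {..D})"
      by (rule dependent_biggerset) (use True in \<open>auto simp: card_image D_def simp del: DIM_cart\<close>)
    then obtain u where u: "\<exists>v\<in>P ` {..D}. u v \<noteq> 0" "(\<Sum>v\<in>P ` {..D}. u v *\<^sub>R v) = 0"
      using dependent_finite[of "P ` {..D}"] by auto
    have "(\<Sum>i\<le>D. u (P i) *\<^sub>R P i) = 0"
      using u(2) by (simp add: sum.reindex[OF True])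
    with u(1) show ?thesis by (intro exI[of _ "\<lambda>i. u (P i)"]) auto
  next
    \<comment> \<open>With repeated powers the image of \<open>P\<close> may be too small for a
      dimension count, but two equal powers give the relation \<open>P i - P j = 0\<close>
      directly.\<close>
    case False
    then obtain i j where ij: "i \<le> D" "j \<le> D" "i \<noteq> j" "P i = P j" by (auto simp: inj_on_def)
    define u where "u k = (if k = i then 1 else if k = j then -1 else (0::real))" for k
    have "(\<Sum>k\<le>D. u k *\<^sub>R P k) = (\<Sum>k\<in>{i,j}. u k *\<^sub>R P k)"
      by (rule sum.mono_neutral_right) (use ij in \<open>auto simp: u_def\<close>)
    also have "\<dots> = 0" using ij by (simp add: u_def)
    finally show ?thesis using ij by (intro exI[of _ u]) (auto simp: u_def)
  qed
  then obtain u :: "nat \<Rightarrow> real" where u: "\<exists>i\<le>D. u i \<noteq> 0" "(\<Sum>i\<le>D. u i *\<^sub>R P i) = 0" by blast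
  define p :: "complex poly" where "p = (\<Sum>i\<le>D. monom (of_real (u i)) i)"
  have cp: "coeff p k = (if k \<le> D then of_real (u k) else 0)" for k
    by (auto simp: p_def coeff_sum coeff_monom)
  have "p \<noteq> 0" using u(1) cp by (metis coeff_0 of_real_eq_0_iff)
  moreover have deg: "degree p \<le> D" by (rule degree_le) (auto simp: cp)
  moreover have "poly_apply p M x = 0" for x
  proof -
    have "poly_apply p M x = (\<Sum>i\<le>D. coeff p i *s (((*v) M) ^^ i) x)"
      unfolding poly_apply_def
      by (rule sum.mono_neutral_left) (use deg in \<open>auto simp: coeff_eq_0\<close>)
    also have "\<dots> = (\<Sum>i\<le>D. (u i *\<^sub>R P i) *v x)"
      by (rule sum.cong)
        (simp_all add: cp P[symmetric] vec_eq_iff matrix_vector_mult_def sum_distrib_left mult_scaleR_left,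
         simp add: scaleR_conv_of_real mult.assoc)
    also have "\<dots> = (\<Sum>i\<le>D. u i *\<^sub>R P i) *v x"
      by (induction D) (simp_all add: matrix_vector_mult_add_rdistrib)
    finally show ?thesis by (simp add: u(2))
  qed
  ultimately show ?thesis unfolding D_def by blast
qed

section \<open>Annihilating products whose factors belong to eigenvalues\<close>

lemma annihilating_list:
  fixes M :: "complex^'n^'n"
  obtains zs where "length zs \<le> DIM(complex^'n^'n)" "\<And>x. shifted_product M zs x = 0"
proof -
  obtain p where p: "p \<noteq> 0" "degree p \<le> DIM(complex^'n^'n)" "\<forall>x. poly_apply p M x = 0"
    using annihilating_poly[of M] by blast
  with poly_apply_eq_shifted_product[OF p(1), of M] show ?thesis
    using that by (metis vec.scale_eq_0_iff)
qed

text \<open>If \<open>z\<close> is not an eigenvalue, then \<open>M - z\<close> is injective; moved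
  to the last position, the factor can be cancelled.\<close>

lemma shifted_product_filter_eigenvalues:
  assumes "shifted_product M zs x = 0"
  shows "shifted_product M (filter (\<lambda>z. z \<in> eigenvalues M) zs) x = 0"
  using assms
proof (induction zs arbitrary: x)
  case (Cons z zs)
  show ?case
  proof (cases "z \<in> eigenvalues M")
    case True
    then show ?thesis using Cons by simp
  next
    case False
    have "M *v shifted_product M zs x = z *s shifted_product M zs x"
      using Cons.prems by (simp add: shifted_product_commute)
    then have "shifted_product M zs x = 0" using False by (auto simp: eigenvalues_def)
    then show ?thesis using Cons.IH False by simp
  qed
qed simp

lemma annihilating_eigenvalue_list:
  fixes M :: "complex^'n^'n"
  obtains zs where "length zs \<le> DIM(complex^'n^'n)" "set zs \<subseteq> eigenvalues M"
    "\<And>x. shifted_product M zs x = 0"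
proof -
  obtain zs where "length zs \<le> DIM(complex^'n^'n)" "\<And>x. shifted_product M zs x = 0"
    using annihilating_list[of M] by blast
  then show ?thesis
    using that[of "filter (\<lambda>z. z \<in> eigenvalues M) zs"] shifted_product_filter_eigenvalues[of M zs]
    by (auto intro: order_trans[OF length_filter_le])
qed

text \<open>Without eigenvalues the annihilating product would be empty, that is, the
  identity.\<close>

lemma eigenvalues_nonempty: "eigenvalues M \<noteq> {}"
proof
  assume "eigenvalues M = {}"
  then have "shifted_product M [] (vec 1) = 0"
    using annihilating_eigenvalue_list[of M] by (metis set_empty subset_empty)
  then show False by (simp add: vec_eq_iff)
qed

lemma shifted_product_eigenvector:
  assumes "M *v v = \<mu> *s v" "\<mu> \<notin> set zs"
  shows "\<exists>c. c \<noteq> 0 \<and> shifted_product M zs v = c *s v"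
  using assms(2)
proof (induction zs)
  case Nil
  show ?case by (intro exI[of _ 1]) simp
next
  case (Cons z zs)
  then obtain c where c: "c \<noteq> 0" "shifted_product M zs v = c *s v" by auto
  have "shifted_product M (z # zs) v = ((\<mu> - z) * c) *s v"
  proof -
    have "shifted_product M (z # zs) v = M *v (c *s v) - z *s (c *s v)"
      by (simp only: shifted_product.simps shifted_product_commute c(2))
    also have "\<dots> = ((\<mu> - z) * c) *s v"
      by (simp add: vector_scalar_commute assms(1) vec.scale_left_diff_distrib ring_distribs mult.commute)
    finally show ?thesis .
  qed
  then show ?case using c(1) Cons.prems by (intro exI[of _ "(\<mu> - z) * c"]) auto
qed

text \<open>Every eigenvalue occurs in an annihilating list: otherwise the product would multiply
  its eigenvector by a nonzero scalar and not annihilate it.\<close>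

lemma finite_eigenvalues: "finite (eigenvalues M)"
proof -
  obtain zs where zs: "\<And>x. shifted_product M zs x = 0"
    using annihilating_list[of M] by blast
  have "eigenvalues M \<subseteq> set zs"
    using zs shifted_product_eigenvector[of M _ _ zs]
    unfolding eigenvalues_def by (smt (verit) mem_Collect_eq subsetI vec.scale_eq_0_iff)
  then show ?thesis using finite_subset by blast
qed

subsection \<open>Approximate eigenvectors for a seminorm\<close>

definition cseminorm :: "(complex^'n \<Rightarrow> real) \<Rightarrow> bool" where
  "cseminorm N \<longleftrightarrow> (\<forall>x y. N (x + y) \<le> N x + N y) \<and> (\<forall>c x. N (c *s x) = cmod c * N x)"

lemma cseminorm_0: "cseminorm N \<Longrightarrow> N 0 = 0"
  unfolding cseminorm_def by (metis mult_zero_left norm_zero vec.scale_zero_left)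

lemma cseminorm_minus: assumes "cseminorm N" shows "N (- x) = N x"
proof -
  have "N ((-1) *s x) = cmod (-1) * N x" using assms unfolding cseminorm_def by blast
  then show ?thesis by simp
qed

lemma cseminorm_triangle: "cseminorm N \<Longrightarrow> N (x + y) \<le> N x + N y"
  by (simp add: cseminorm_def)

lemma cseminorm_diff: "cseminorm N \<Longrightarrow> N (x - y) \<le> N x + N y"
  by (metis cseminorm_minus cseminorm_triangle diff_conv_add_uminus)

lemma cseminorm_nonneg: assumes "cseminorm N" shows "0 \<le> N x"
  using cseminorm_diff[OF assms, of x x] cseminorm_0[OF assms] by simp

lemma cseminorm_scale: "cseminorm N \<Longrightarrow> N (c *s x) = cmod c * N x"
  by (simp add: cseminorm_def)

lemma vector_smult_of_real: "complex_of_real a *s x = a *\<^sub>R x"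
  by (simp add: vec_eq_iff) (simp add: scaleR_conv_of_real)

lemma cseminorm_scaleR: "cseminorm N \<Longrightarrow> N (a *\<^sub>R x) = \<bar>a\<bar> * N x"
  by (simp add: cseminorm_scale flip: vector_smult_of_real)

lemma cseminorm_norm: "cseminorm (norm :: complex^'n \<Rightarrow> real)"
  unfolding cseminorm_def
proof (intro conjI allI)
  fix c and x :: "complex^'n"
  have "norm (c *s x) = L2_set (\<lambda>i. cmod c * norm (x $ i)) UNIV"
    by (simp add: norm_vec_def norm_mult)
  also have "\<dots> = cmod c * norm x"
    by (simp add: norm_vec_def L2_set_right_distrib)
  finally show "norm (c *s x) = cmod c * norm x" .
qed (rule norm_triangle_ineq)

lemma cseminorm_le_sum_Basis:
  assumes N: "cseminorm N"
  shows "N x \<le> (\<Sum>b\<in>Basis. N b) * norm x"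
proof -
  have sum: "N (sum f F) \<le> (\<Sum>b\<in>F. N (f b))" if "finite F" for f and F :: "(complex^'n) set"
    using that
  proof (induction F)
    case (insert a F)
    then show ?case using cseminorm_triangle[OF N, of "f a" "sum f F"] by simp
  qed (simp add: cseminorm_0[OF N])
  have "N x = N (\<Sum>b\<in>Basis. (x \<bullet> b) *\<^sub>R b)" by (simp add: euclidean_representation)
  also have "\<dots> \<le> (\<Sum>b\<in>Basis. N ((x \<bullet> b) *\<^sub>R b))" by (rule sum) simp
  also have "\<dots> = (\<Sum>b\<in>Basis. \<bar>x \<bullet> b\<bar> * N b)" by (simp add: cseminorm_scaleR[OF N])
  also have "\<dots> \<le> (\<Sum>b\<in>Basis. norm x * N b)"
    by (intro sum_mono mult_right_mono Basis_le_norm cseminorm_nonneg[OF N])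
  finally show ?thesis by (simp add: sum_distrib_left mult.commute)
qed

text \<open>On an approximate eigenvector for \<alpha> each factor \<open>M - z\<close> acts almost
  as multiplication by \<alpha> - z, of modulus at least \<delta>. The residual is mapped along by
  the same factors and grows by at most \<open>L\<close> each time.\<close>

lemma shifted_product_lower_bound:
  fixes N :: "complex^'n \<Rightarrow> real" and L :: real
  assumes N: "cseminorm N" and M: "\<And>x. N (M *v x) \<le> m * N x"
    and zs: "\<And>z. z \<in> set zs \<Longrightarrow> \<delta> \<le> cmod (\<alpha> - z) \<and> m + cmod z \<le> L"
    and L: "0 < \<delta>" "\<delta> \<le> L" "1 \<le> L"
  shows "\<delta> ^ length zs * N x \<le> N (shifted_product M zs x) + length zs * L ^ length zs * N (M *v x - \<alpha> *s x)"
  using zs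
proof (induction zs arbitrary: x)
  case (Cons z zs)
  let ?n = "length zs"
  define y e where "y = M *v x - z *s x" and "e = N (M *v x - \<alpha> *s x)"
  have e0: "0 \<le> e" unfolding e_def by (rule cseminorm_nonneg[OF N])
  have z: "\<delta> \<le> cmod (\<alpha> - z)" "m + cmod z \<le> L" using Cons.prems by auto
  have "(\<alpha> - z) *s x = y - (M *v x - \<alpha> *s x)"
    by (simp add: y_def vec.scale_left_diff_distrib)
  then have "cmod (\<alpha> - z) * N x \<le> N y + e"
    using cseminorm_diff[OF N, of y "M *v x - \<alpha> *s x"] cseminorm_scale[OF N] by (metis e_def)
  moreover have "\<delta> * N x \<le> cmod (\<alpha> - z) * N x"
    using z(1) cseminorm_nonneg[OF N] by (rule mult_right_mono)
  ultimately have 1: "\<delta> * N x \<le> N y + e" by simp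
  \<comment> \<open>Since the factors commute, the residual of \<open>y\<close> is the image of the
    residual \<open>r\<close> of \<open>x\<close> under \<open>M - z\<close>.\<close>
  define r where "r = M *v x - \<alpha> *s x"
  have "M *v y - \<alpha> *s y = M *v r - z *s r"
    by (simp add: y_def r_def matrix_vector_mult_diff_distrib vec.scale_right_diff_distrib
        vector_scalar_commute mult.commute)
  then have "N (M *v y - \<alpha> *s y) \<le> N (M *v r) + cmod z * N r"
    using cseminorm_diff[OF N] cseminorm_scale[OF N] by metis
  also have "\<dots> \<le> (m + cmod z) * e" using M[of r] by (simp add: e_def r_def ring_distribs)
  also have "\<dots> \<le> L * e" using z(2) e0 by (rule mult_right_mono)
  finally have 2: "N (M *v y - \<alpha> *s y) \<le> L * e" .
  have IH: "\<delta> ^ ?n * N y \<le> N (shifted_product M zs y) + ?n * L ^ ?n * N (M *v y - \<alpha> *s y)"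
    using Cons by auto
  have "\<delta> ^ Suc ?n * N x \<le> \<delta> ^ ?n * (N y + e)"
    using mult_left_mono[OF 1, of "\<delta> ^ ?n"] L(1) by (simp add: mult_ac)
  also have "\<dots> \<le> N (shifted_product M zs y) + ?n * L ^ ?n * N (M *v y - \<alpha> *s y) + \<delta> ^ ?n * e"
    using IH by (simp add: ring_distribs)
  also have "\<dots> \<le> N (shifted_product M zs y) + ?n * L ^ ?n * (L * e) + L ^ Suc ?n * e"
  proof -
    have "\<delta> ^ ?n \<le> L ^ ?n" using L by (intro power_mono) auto
    also have "\<dots> \<le> L ^ Suc ?n" using L by (intro power_increasing) auto
    finally have "\<delta> ^ ?n * e \<le> L ^ Suc ?n * e" using e0 by (rule mult_right_mono)
    moreover have "?n * L ^ ?n * N (M *v y - \<alpha> *s y) \<le> ?n * L ^ ?n * (L * e)"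
      using 2 L by (intro mult_left_mono) auto
    ultimately show ?thesis by linarith
  qed
  finally show ?case by (simp add: y_def e_def algebra_simps)
qed simp

text \<open>Apply the lower bound to an annihilating product over eigenvalues: its main term
  vanishes, so only the residual remains on the right. The constants depend on \<open>m\<close>,
  \<open>t\<close> and \<alpha> but not on \<open>M\<close>, which makes the estimate usable for
  infinitely many words and for perturbed matrices.\<close>

lemma approximate_eigenvector_bound:
  fixes M :: "complex^'n^'n" and N :: "complex^'n \<Rightarrow> real"
  assumes N: "cseminorm N" and M: "\<And>x. N (M *v x) \<le> m * N x" and m: "0 \<le> m"
    and eig: "\<And>\<mu>. \<mu> \<in> eigenvalues M \<Longrightarrow> cmod \<mu> \<le> t" and t: "t < cmod \<alpha>"
    and L: "L = 1 + m + cmod \<alpha>"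
  shows "((cmod \<alpha> - t) / L) ^ DIM(complex^'n^'n) * N x \<le> DIM(complex^'n^'n) * N (M *v x - \<alpha> *s x)"
proof -
  obtain zs where zs: "length zs \<le> DIM(complex^'n^'n)" "set zs \<subseteq> eigenvalues M"
    "\<And>x. shifted_product M zs x = 0"
    using annihilating_eigenvalue_list by blast
  define n D where "n = length zs" and "D = DIM(complex^'n^'n)"
  define \<delta> e where "\<delta> = cmod \<alpha> - t" and "e = N (M *v x - \<alpha> *s x)"
  have t0: "0 \<le> t" using eigenvalues_nonempty[of M] eig by (metis all_not_in_conv norm_ge_zero order_trans)
  have L1: "0 < \<delta>" "\<delta> \<le> L" "1 \<le> L" using t m t0 by (auto simp: \<delta>_def L)
  have e0: "0 \<le> e" unfolding e_def by (rule cseminorm_nonneg[OF N])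
  have "\<delta> ^ n * N x \<le> N (shifted_product M zs x) + n * L ^ n * e"
    unfolding n_def e_def
  proof (rule shifted_product_lower_bound[OF N M _ L1])
    fix z assume "z \<in> set zs"
    then have "cmod z \<le> t" using zs(2) eig by auto
    moreover have "cmod \<alpha> - cmod z \<le> cmod (\<alpha> - z)" by (rule norm_triangle_ineq2)
    ultimately show "\<delta> \<le> cmod (\<alpha> - z) \<and> m + cmod z \<le> L" using t by (auto simp: \<delta>_def L)
  qed
  then have "\<delta> ^ n * N x \<le> (n * e) * L ^ n" using zs(3) cseminorm_0[OF N] by (simp add: mult_ac)
  then have 1: "(\<delta> / L) ^ n * N x \<le> n * e"
    using L1 by (simp add: power_divide divide_simps)
  \<comment> \<open>As \<delta> / L is at most 1, the list length \<open>n\<close> may be replaced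
    by its uniform bound \<open>D\<close>.\<close>
  have "(\<delta> / L) ^ D \<le> (\<delta> / L) ^ n"
    using L1 zs(1) by (intro power_decreasing) (auto simp: n_def D_def)
  then have "(\<delta> / L) ^ D * N x \<le> (\<delta> / L) ^ n * N x"
    using cseminorm_nonneg[OF N] by (rule mult_right_mono)
  moreover have "n * e \<le> D * e" using zs(1) e0 unfolding n_def D_def by (intro mult_right_mono of_nat_mono)
  ultimately show ?thesis using 1 unfolding D_def e_def \<delta>_def by linarith
qed

section \<open>Products along admissible words\<close>

text \<open>
  \<open>admissible E i w\<close> says that the word \<open>w\<close> may follow the letter \<open>i\<close>. A word \<open>w\<close> is thus periodic
  if it is nonempty and \<open>admissible E (last w) w\<close>.
\<close>

primrec admissible :: "('k \<Rightarrow> 'k \<Rightarrow> bool) \<Rightarrow> 'k \<Rightarrow> 'k list \<Rightarrow> bool" where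
  "admissible E i [] = True"
| "admissible E i (j # w) = (E i j \<and> admissible E j w)"

lemma admissible_append: "admissible E i (u @ v) \<longleftrightarrow> admissible E i u \<and> admissible E (last (i # u)) v"
  by (induction u arbitrary: i) auto

primrec cword :: "('k \<Rightarrow> complex^'n^'n) \<Rightarrow> 'k list \<Rightarrow> complex^'n^'n" where
  "cword A [] = mat 1"
| "cword A (j # w) = cword A w ** A j"

lemma cword_Nil_apply [simp]: "cword A [] *v x = x"
  by simp

lemma cword_Cons_apply: "cword A (j # w) *v x = cword A w *v (A j *v x)"
  by (simp add: matrix_vector_mul_assoc)

lemma cword_append_apply: "cword A (u @ w) *v x = cword A w *v (cword A u *v x)"
  by (induction u arbitrary: x) (simp_all add: cword_Cons_apply del: cword.simps)

lemma linear_matrix_vector_mult: "linear ((*v) (M :: complex^'n^'m))"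
  using matrix_vector_mul_bounded_linear[of M] by (rule bounded_linear.linear)

lemma scaleR_matrix_vector_mult: "(c *\<^sub>R M) *v x = c *\<^sub>R (M *v x)" for M :: "complex^'n^'m"
  by (simp add: vec_eq_iff matrix_vector_mult_def scaleR_sum_right)

lemma cword_scale_apply:
  "cword (\<lambda>j. c *\<^sub>R A j) w *v x = (c ^ length w) *\<^sub>R (cword A w *v x)"
proof (induction w arbitrary: x)
  case (Cons j w)
  then show ?case
    by (simp add: cword_Cons_apply scaleR_matrix_vector_mult linear_cmul[OF linear_matrix_vector_mult]
        mult.commute del: cword.simps)
qed (simp del: cword.simps)

lemma norm_linear_le_sum_Basis:
  fixes f :: "'a::euclidean_space \<Rightarrow> 'b::real_normed_vector"
  assumes "linear f"
  shows "norm (f x) \<le> (\<Sum>b\<in>Basis. norm (f b)) * norm x"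
proof -
  have "f x = (\<Sum>b\<in>Basis. (x \<bullet> b) *\<^sub>R f b)"
    by (subst euclidean_representation[of x, symmetric])
      (simp only: linear_sum[OF assms] linear_cmul[OF assms])
  also have "norm \<dots> \<le> (\<Sum>b\<in>Basis. \<bar>x \<bullet> b\<bar> * norm (f b))"
    by (rule order_trans[OF norm_sum]) simp
  also have "\<dots> \<le> (\<Sum>b\<in>Basis. norm x * norm (f b))"
    by (intro sum_mono mult_right_mono Basis_le_norm) auto
  finally show ?thesis by (simp add: sum_distrib_left mult.commute)
qed

lemma family_bound:
  fixes A :: "'k::finite \<Rightarrow> complex^'n^'n"
  obtains K :: real where "K \<ge> c" "\<And>j x. norm (A j *v x) \<le> K * norm x"
proof
  define K where "K = \<bar>c\<bar> + (\<Sum>j\<in>UNIV. \<Sum>b\<in>Basis. norm (A j *v b))"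
  show "K \<ge> c" unfolding K_def by (smt (verit) sum_nonneg norm_ge_zero)
  show "norm (A j *v x) \<le> K * norm x" for j x
  proof -
    have "(\<Sum>b\<in>Basis. norm (A j *v b)) \<le> (\<Sum>j\<in>UNIV. \<Sum>b\<in>Basis. norm (A j *v b))"
      by (rule member_le_sum[of j UNIV "\<lambda>j. \<Sum>b\<in>Basis. norm (A j *v b)"]) (auto intro: sum_nonneg)
    then have "(\<Sum>b\<in>Basis. norm (A j *v b)) \<le> K" by (simp add: K_def)
    then show ?thesis
      using norm_linear_le_sum_Basis[OF linear_matrix_vector_mult, of "A j" x]
      by (meson mult_right_mono norm_ge_zero order_trans)
  qed
qed

lemma cword_norm_le_power:
  assumes "\<And>j x. norm (A j *v x) \<le> K * norm x" "0 \<le> K"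
  shows "norm (cword A w *v x) \<le> K ^ length w * norm x"
proof (induction w arbitrary: x)
  case (Cons j w)
  have "norm (cword A (j # w) *v x) \<le> K ^ length w * norm (A j *v x)"
    using Cons by (simp add: cword_Cons_apply del: cword.simps)
  also have "\<dots> \<le> K ^ length w * (K * norm x)"
    using assms by (intro mult_left_mono) auto
  finally show ?case by (simp add: mult_ac)
qed simp

text \<open>The infimum of the positive \<open>s\<close> with this property is the joint spectral
  radius of the constrained system.\<close>

definition growth_bound :: "('k \<Rightarrow> 'k \<Rightarrow> bool) \<Rightarrow> ('k \<Rightarrow> complex^'n^'n) \<Rightarrow> real \<Rightarrow> bool" where
  "growth_bound E A s \<longleftrightarrow>
     (\<exists>C\<ge>0. \<forall>i w x. admissible E i w \<longrightarrow> norm (cword A w *v x) \<le> C * s ^ length w * norm x)"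

lemma growth_bound_mono:
  assumes "growth_bound E A s" "0 \<le> s" "s \<le> t"
  shows "growth_bound E A t"
proof -
  obtain C where C: "C \<ge> 0" "\<And>i w x. admissible E i w \<Longrightarrow> norm (cword A w *v x) \<le> C * s ^ length w * norm x"
    using assms(1) unfolding growth_bound_def by blast
  have "norm (cword A w *v x) \<le> C * t ^ length w * norm x" if "admissible E i w" for i w x
  proof -
    have "C * s ^ length w * norm x \<le> C * t ^ length w * norm x"
      using C(1) assms by (intro mult_right_mono mult_left_mono power_mono) auto
    then show ?thesis using C(2)[OF that, of x] by linarith
  qed
  then show ?thesis using C(1) unfolding growth_bound_def by blast
qed

text \<open>By submultiplicativity a bound at one length \<open>n\<close> suffices: cut a word into
  blocks of length \<open>n\<close> and estimate the shorter remainder crudely.\<close>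

lemma growth_boundI:
  fixes A :: "'k::finite \<Rightarrow> complex^'n^'n"
  assumes n: "n > 0" and q: "q > 0"
    and bnd: "\<And>i w x. admissible E i w \<Longrightarrow> length w = n \<Longrightarrow> norm (cword A w *v x) \<le> q ^ n * norm x"
  shows "growth_bound E A q"
proof -
  obtain K where K: "K \<ge> q" "\<And>j x. norm (A j *v x) \<le> K * norm x"
    using family_bound[of q A] by blast
  have K0: "K > 0" using K q by simp
  \<comment> \<open>Because \<open>K / q\<close> is at least 1, its \<open>n\<close>-th power covers
    every remainder shorter than \<open>n\<close>.\<close>
  define C where "C = (K / q) ^ n"
  have C: "C \<ge> 0" using K0 q by (simp add: C_def)
  have "norm (cword A w *v x) \<le> C * q ^ length w * norm x" if "admissible E i w" for i w x
    using that
  proof (induction "length w" arbitrary: w i x rule: less_induct)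
    case less
    show ?case
    proof (cases "length w < n")
      case True
      have "K ^ length w = (K / q) ^ length w * q ^ length w"
        using q by (simp add: power_divide)
      also have "\<dots> \<le> C * q ^ length w"
        unfolding C_def using True K q by (intro mult_right_mono power_increasing) auto
      finally have "K ^ length w * norm x \<le> C * q ^ length w * norm x"
        by (intro mult_right_mono) auto
      then show ?thesis using cword_norm_le_power[of A K w x, OF K(2)] K0 by linarith
    next
      case False
      define u v where "u = take n w" and "v = drop n w"
      have w: "w = u @ v" and u: "length u = n" and v: "length w = n + length v"
        using False by (auto simp: u_def v_def)
      have p: "admissible E i u" "admissible E (last (i # u)) v" using less.prems by (auto simp: w admissible_append)
      have "norm (cword A w *v x) \<le> C * q ^ length v * norm (cword A u *v x)"
        unfolding w cword_append_apply using less.hyps[OF _ p(2)] v n by simp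
      also have "\<dots> \<le> C * q ^ length v * (q ^ n * norm x)"
        using bnd[OF p(1) u] C q by (intro mult_left_mono) auto
      finally show ?thesis by (simp add: v power_add mult_ac)
    qed
  qed
  then show ?thesis using C unfolding growth_bound_def by blast
qed

subsection \<open>A Barabanov seminorm\<close>

text \<open>By Tychonoff's theorem the sequence stays in a compact product of intervals and has a
  cluster point \<open>g\<close>, which inherits every closed condition that holds eventually. The
  index set may be uncountable, so a cluster point takes the place of the limit of a
  subsequence.\<close>

lemma cluster_function:
  fixes h :: "nat \<Rightarrow> 'a \<Rightarrow> real" and B :: "'a \<Rightarrow> real"
  assumes "\<And>k p. 0 \<le> h k p \<and> h k p \<le> B p"
  obtains g where "\<And>C. closed C \<Longrightarrow> eventually (\<lambda>k. h k \<in> C) sequentially \<Longrightarrow> g \<in> C"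
proof -
  define U where "U = (\<Pi>\<^sub>E p\<in>(UNIV::'a set). {0..B p})"
  have "compactin (product_topology (\<lambda>p. euclidean) UNIV) U"
    unfolding U_def by (simp add: compactin_PiE)
  then have "compact U" by (simp add: euclidean_product_topology)
  moreover have "filtermap h sequentially \<noteq> bot" by (simp add: filtermap_bot_iff)
  moreover have "eventually (\<lambda>x. x \<in> U) (filtermap h sequentially)"
    using assms by (simp add: eventually_filtermap U_def PiE_UNIV_domain)
  ultimately obtain g where g: "inf (nhds g) (filtermap h sequentially) \<noteq> bot"
    unfolding compact_filter by blast
  show ?thesis
  proof (rule that)
    fix C assume C: "closed C" "eventually (\<lambda>k. h k \<in> C) sequentially"
    show "g \<in> C"
    proof (rule ccontr)
      assume "g \<notin> C"
      then have "eventually (\<lambda>x. x \<in> - C) (nhds g)"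
        using C(1) by (intro eventually_nhds_in_open) auto
      moreover have "eventually (\<lambda>x. x \<in> C) (filtermap h sequentially)"
        using C(2) by (simp add: eventually_filtermap)
      ultimately have "eventually (\<lambda>x. False) (inf (nhds g) (filtermap h sequentially))"
        unfolding eventually_inf by (intro exI conjI) auto
      then show False using g by (simp add: eventually_False)
    qed
  qed
qed

text \<open>
  The factor \<open>length w + 1\<close> makes the supremum blow up as \<open>s\<close> decreases to the joint growth rate
  even if the products, divided by their growth rate, stay bounded.
\<close>

definition growth_norm :: "('k \<Rightarrow> 'k \<Rightarrow> bool) \<Rightarrow> ('k \<Rightarrow> complex^'n^'n) \<Rightarrow> real \<Rightarrow> 'k \<Rightarrow> complex^'n \<Rightarrow> real" where
  "growth_norm E A s i x =
     (SUP w\<in>{w. admissible E i w}. (real (length w) + 1) * norm (cword A w *v x) / s ^ length w)"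

lemma linear_times_power_bounded:
  fixes q :: real
  assumes "0 \<le> q" "q < 1"
  obtains B where "\<And>n. (real n + 1) * q ^ n \<le> B"
proof -
  have "(\<lambda>n. real n * q ^ n + q ^ n) \<longlonglongrightarrow> 0 + 0"
    using assms by (intro tendsto_add powser_times_n_limit_0 LIMSEQ_power_zero) auto
  then have "Bseq (\<lambda>n. (real n + 1) * q ^ n)"
    by (intro convergent_imp_Bseq convergentI[where L = 0]) (simp add: algebra_simps)
  then obtain K where "\<And>n. norm ((real n + 1) * q ^ n) \<le> K" unfolding Bseq_def by blast
  then show ?thesis by (intro that[of K]) (use abs_le_D1 in auto)
qed

context
  fixes E :: "'k::finite \<Rightarrow> 'k \<Rightarrow> bool" and A :: "'k \<Rightarrow> complex^'n^'n"
  assumes growth: "\<And>s. 1 < s \<Longrightarrow> growth_bound E A s"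
begin

lemma growth_norm_bdd:
  assumes "1 < s"
  shows "bdd_above ((\<lambda>w. (real (length w) + 1) * norm (cword A w *v x) / s ^ length w) ` {w. admissible E i w})"
proof -
  \<comment> \<open>A rate strictly between 1 and \<open>s\<close> leaves the geometric factor
    \<open>(t / s) ^ n\<close>, which absorbs the linear weight.\<close>
  define t where "t = (1 + s) / 2"
  have t: "1 < t" "t < s" using assms by (auto simp: t_def)
  obtain C where C: "C \<ge> 0" "\<And>i w x. admissible E i w \<Longrightarrow> norm (cword A w *v x) \<le> C * t ^ length w * norm x"
    using growth[OF t(1)] unfolding growth_bound_def by blast
  obtain B where B: "\<And>n. (real n + 1) * (t / s) ^ n \<le> B"
    using linear_times_power_bounded[of "t / s"] t by auto
  have "(real (length w) + 1) * norm (cword A w *v x) / s ^ length w \<le> B * C * norm x"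
    if "admissible E i w" for w
  proof -
    have "(real (length w) + 1) * norm (cword A w *v x) / s ^ length w
        \<le> (real (length w) + 1) * (C * t ^ length w * norm x) / s ^ length w"
      using C(2)[OF that, of x] assms by (intro divide_right_mono mult_left_mono) auto
    also have "\<dots> = ((real (length w) + 1) * (t / s) ^ length w) * (C * norm x)"
      by (simp add: power_divide)
    also have "\<dots> \<le> B * (C * norm x)"
      using B C(1) by (intro mult_right_mono) auto
    finally show ?thesis by (simp add: mult_ac)
  qed
  then show ?thesis by (intro bdd_aboveI[where M = "B * C * norm x"]) auto
qed

lemma growth_norm_ge:
  assumes "1 < s" "admissible E i w"
  shows "(real (length w) + 1) * norm (cword A w *v x) / s ^ length w \<le> growth_norm E A s i x"
  unfolding growth_norm_def using growth_norm_bdd[OF assms(1)] assms(2) by (intro cSUP_upper) auto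

lemma growth_norm_le:
  assumes "\<And>w. admissible E i w \<Longrightarrow> (real (length w) + 1) * norm (cword A w *v x) / s ^ length w \<le> b"
  shows "growth_norm E A s i x \<le> b"
  unfolding growth_norm_def using assms by (intro cSUP_least) (auto intro: exI[of _ "[]"])

lemma growth_norm_ge_norm: "1 < s \<Longrightarrow> norm x \<le> growth_norm E A s i x"
  using growth_norm_ge[of s i "[]" x] by simp

lemma cseminorm_growth_norm:
  assumes s: "1 < s"
  shows "cseminorm (growth_norm E A s i)"
proof -
  have tri: "growth_norm E A s i (x + y) \<le> growth_norm E A s i x + growth_norm E A s i y" for x y
  proof (rule growth_norm_le)
    fix w assume w: "admissible E i w"
    let ?c = "(real (length w) + 1) / s ^ length w"
    have "?c * norm (cword A w *v (x + y)) \<le> ?c * (norm (cword A w *v x) + norm (cword A w *v y))"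
      using s by (intro mult_left_mono) (auto simp: matrix_vector_right_distrib norm_triangle_ineq)
    then show "(real (length w) + 1) * norm (cword A w *v (x + y)) / s ^ length w
        \<le> growth_norm E A s i x + growth_norm E A s i y"
      using growth_norm_ge[OF s w, of x] growth_norm_ge[OF s w, of y] by (simp add: ring_distribs add_divide_distrib)
  qed
  have le: "growth_norm E A s i (c *s x) \<le> cmod c * growth_norm E A s i x" for c x
  proof (rule growth_norm_le)
    fix w assume w: "admissible E i w"
    have "(real (length w) + 1) * norm (cword A w *v (c *s x)) / s ^ length w =
      cmod c * ((real (length w) + 1) * norm (cword A w *v x) / s ^ length w)"
      by (simp add: vector_scalar_commute cseminorm_scale[OF cseminorm_norm])
    also have "\<dots> \<le> cmod c * growth_norm E A s i x"
      using growth_norm_ge[OF s w, of x] by (intro mult_left_mono) auto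
    finally show "(real (length w) + 1) * norm (cword A w *v (c *s x)) / s ^ length w
        \<le> cmod c * growth_norm E A s i x" .
  qed
  have "growth_norm E A s i (c *s x) = cmod c * growth_norm E A s i x" for c x
  proof (cases "c = 0")
    case True
    then show ?thesis using le[of 0 x] growth_norm_ge_norm[OF s, of 0 i] by simp
  next
    case False
    then have "x = inverse c *s (c *s x)" by simp
    then have "growth_norm E A s i x \<le> cmod (inverse c) * growth_norm E A s i (c *s x)"
      using le by metis
    then have "cmod c * growth_norm E A s i x \<le> growth_norm E A s i (c *s x)"
      using False by (simp add: norm_inverse norm_divide field_simps)
    then show ?thesis using le[of c x] by simp
  qed
  then show ?thesis using tri unfolding cseminorm_def by blast
qed

text \<open>Prepending \<open>j\<close> turns a word after \<open>j\<close> into a word after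
  \<open>i\<close>: the weight only increases, and the normalisation costs one factor
  \<open>s\<close>.\<close>

lemma growth_norm_step:
  assumes s: "1 < s" and ij: "E i j"
  shows "growth_norm E A s j (A j *v x) \<le> s * growth_norm E A s i x"
proof (rule growth_norm_le)
  fix w assume w: "admissible E j w"
  have "(real (length w) + 1) * norm (cword A w *v (A j *v x)) / s ^ length w
     \<le> (real (length (j # w)) + 1) * norm (cword A (j # w) *v x) / s ^ length w"
    unfolding cword_Cons_apply using s by (intro divide_right_mono mult_right_mono) auto
  also have "\<dots> = s * ((real (length (j # w)) + 1) * norm (cword A (j # w) *v x) / s ^ length (j # w))"
    using s by simp
  also have "\<dots> \<le> s * growth_norm E A s i x"
    using s ij w by (intro mult_left_mono growth_norm_ge) auto
  finally show "(real (length w) + 1) * norm (cword A w *v (A j *v x)) / s ^ length w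
     \<le> s * growth_norm E A s i x" .
qed

text \<open>An approximate converse of the previous inequality. Words shorter than \<open>m\<close>
  contribute a bounded amount, which disappears after normalisation; from a longer word the first
  letter can be removed, and the weight then changes by a factor of at most
  \<open>1 + 1 / m\<close>.\<close>

lemma growth_norm_extend:
  assumes m: "0 < m" and K: "1 \<le> K" "\<And>j x. norm (A j *v x) \<le> K * norm x" and s: "1 < s"
  shows "growth_norm E A s i x \<le> m * K ^ m * norm x \<or>
    (\<exists>j. E i j \<and> growth_norm E A s i x \<le> (1 + 1 / real m) * growth_norm E A s j (A j *v x))"
proof -
  \<comment> \<open>All candidate bounds form a finite set, so the supremum is at most its largest
    element, which is one of the alternatives claimed.\<close>
  define S where "S = insert (m * K ^ m * norm x) ((\<lambda>j. (1 + 1 / real m) * growth_norm E A s j (A j *v x)) ` {j. E i j})"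
  have S: "finite S" by (simp add: S_def)
  have "growth_norm E A s i x \<le> Max S"
  proof (rule growth_norm_le)
    fix w assume w: "admissible E i w"
    show "(real (length w) + 1) * norm (cword A w *v x) / s ^ length w \<le> Max S"
    proof (cases "length w < m")
      case True
      have "(real (length w) + 1) * norm (cword A w *v x) / s ^ length w
          \<le> (real (length w) + 1) * norm (cword A w *v x) / 1"
        using s one_le_power[of s "length w"] by (intro divide_left_mono) auto
      also have "\<dots> \<le> m * (K ^ length w * norm x)"
        unfolding div_by_1 using True K cword_norm_le_power[of A K w x, OF K(2)] by (intro mult_mono) auto
      also have "\<dots> \<le> m * (K ^ m * norm x)"
        using True K by (intro mult_left_mono mult_right_mono power_increasing) auto
      also have "\<dots> \<le> Max S" using S by (intro Max_ge) (auto simp: S_def)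
      finally show ?thesis .
    next
      case False
      then obtain j u where ju: "w = j # u" using m by (cases w) auto
      then have j: "E i j" "admissible E j u" using w by auto
      \<comment> \<open>\<open>l\<close> is both the length of \<open>w\<close> and the weight of
        \<open>u\<close>, so removing \<open>j\<close> changes the weight from \<open>l + 1\<close>
        to \<open>l\<close>.\<close>
      define l where "l = real (length u) + 1"
      have l: "l \<ge> m" using False ju by (simp add: l_def)
      have "(real (length w) + 1) * norm (cword A w *v x) / s ^ length w
         = (l + 1) * norm (cword A u *v (A j *v x)) / (s * s ^ length u)"
        by (simp add: ju cword_Cons_apply l_def del: cword.simps)
      also have "\<dots> = ((l + 1) / (l * s)) * (l * norm (cword A u *v (A j *v x)) / s ^ length u)"
        using l m s by (simp add: divide_simps)
      also have "\<dots> \<le> (1 + 1 / m) * growth_norm E A s j (A j *v x)"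
      proof (rule mult_mono)
        have "(l + 1) / (l * s) \<le> (l + 1) / l" using l m s by (intro divide_left_mono) auto
        also have "\<dots> = 1 + 1 / l" using l m by (simp add: field_simps)
        also have "\<dots> \<le> 1 + 1 / m" using l m by (intro add_left_mono divide_left_mono) auto
        finally show "(l + 1) / (l * s) \<le> 1 + 1 / m" .
        show "l * norm (cword A u *v (A j *v x)) / s ^ length u \<le> growth_norm E A s j (A j *v x)"
          unfolding l_def using growth_norm_ge[OF s j(2)] by simp
      qed (use s l in auto)
      also have "\<dots> \<le> Max S" using S j by (intro Max_ge) (auto simp: S_def)
      finally show ?thesis .
    qed
  qed
  moreover have "Max S \<in> S" using S by (intro Max_in) (auto simp: S_def)
  ultimately show ?thesis unfolding S_def by auto
qed

text \<open>Here the linear weight pays off. If the weighted norms were bounded, products of length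
  \<open>n\<close> would have norm O(1/n), hence at most 1/2 for some \<open>n\<close>, and
  submultiplicativity would give a growth rate below 1.\<close>

lemma unbounded_growth:
  assumes "\<And>q. 0 < q \<Longrightarrow> q < 1 \<Longrightarrow> \<not> growth_bound E A q"
  shows "\<exists>i w. \<exists>b\<in>Basis. admissible E i w \<and> R < (real (length w) + 1) * norm (cword A w *v b)"
proof (rule ccontr)
  assume "\<not> ?thesis"
  then have R: "(real (length w) + 1) * norm (cword A w *v b) \<le> R" if "admissible E i w" "b \<in> Basis" for i w b
    using that by force
  define D where "D = real DIM(complex^'n)"
  obtain n :: nat where n: "2 * D * R < n" "0 < n"
    using reals_Archimedean2[of "max 0 (2 * D * R)"] by auto
  have "growth_bound E A (root n (1/2))"
  proof (rule growth_boundI[OF n(2)])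
    fix i w and x :: "complex^'n" assume w: "admissible E i w" "length w = n"
    have "norm (cword A w *v b) \<le> R / (n + 1)" if "b \<in> Basis" for b
      using R[OF w(1) that] w(2) by (simp add: field_simps)
    then have "(\<Sum>b\<in>Basis. norm (cword A w *v b)) \<le> D * (R / (n + 1))"
      unfolding D_def by (intro sum_bounded_above) auto
    also have "\<dots> \<le> 1 / 2" using n by (simp add: field_simps)
    finally have "(\<Sum>b\<in>Basis. norm (cword A w *v b)) * norm x \<le> 1 / 2 * norm x"
      by (intro mult_right_mono) auto
    then show "norm (cword A w *v x) \<le> root n (1/2) ^ n * norm x"
      using norm_linear_le_sum_Basis[OF linear_matrix_vector_mult, of "cword A w" x] n by simp
  qed (use n in auto)
  moreover have "0 < root n (1/2)" "root n (1/2) < 1" using n by auto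
  ultimately show False using assms by blast
qed

text \<open>Let \<open>s k\<close> decrease to 1 and divide the growth norms by their sum
  \<open>S k\<close> over all letters and basis vectors. This sum tends to infinity, which removes
  the short-word alternative, while the normalisation keeps the cluster point from
  vanishing.\<close>

lemma barabanov_seminorm:
  assumes ng: "\<And>q. 0 < q \<Longrightarrow> q < 1 \<Longrightarrow> \<not> growth_bound E A q"
  obtains N :: "'k \<Rightarrow> complex^'n \<Rightarrow> real" where
    "\<And>i. cseminorm (N i)"
    "\<And>i j x. E i j \<Longrightarrow> N j (A j *v x) \<le> N i x"
    "\<And>i x. 0 < N i x \<Longrightarrow> \<exists>j. E i j \<and> N i x \<le> N j (A j *v x)"
    "\<exists>i x. 0 < N i x"
proof -
  define s where "s k = 1 + 1 / (real k + 1)" for k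
  have s: "1 < s k" for k by (simp add: s_def)
  have s_lim: "s \<longlonglongrightarrow> 1"
    unfolding s_def using LIMSEQ_inverse_real_of_nat_add[of 1] by (simp add: inverse_eq_divide add.commute)
  define S where "S k = (\<Sum>i\<in>UNIV. \<Sum>b\<in>Basis. growth_norm E A (s k) i b)" for k
  have nn: "0 \<le> growth_norm E A (s k) i x" for k i x
    by (rule cseminorm_nonneg[OF cseminorm_growth_norm[OF s]])
  have S_ge: "growth_norm E A (s k) i b \<le> S k" if "b \<in> Basis" for k i b
  proof -
    have "growth_norm E A (s k) i b \<le> (\<Sum>b\<in>Basis. growth_norm E A (s k) i b)"
      using that nn by (intro member_le_sum) auto
    also have "\<dots> \<le> S k" unfolding S_def
      by (rule member_le_sum[of i UNIV "\<lambda>i. \<Sum>b\<in>Basis. growth_norm E A (s k) i b"]) (auto intro: sum_nonneg nn)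
    finally show ?thesis .
  qed
  have S_pos: "0 < S k" for k
  proof -
    obtain b :: "complex^'n" where b: "b \<in> Basis" using nonempty_Basis by blast
    have "1 \<le> growth_norm E A (s k) undefined b" using growth_norm_ge_norm[OF s, of b] b by simp
    then show ?thesis using S_ge[OF b, of k undefined] by linarith
  qed
  have S_inf: "eventually (\<lambda>k. R \<le> S k) sequentially" for R
  proof -
    \<comment> \<open>A single word with weighted norm above \<open>R\<close> suffices, since its
      term in the growth norm tends to that weighted norm as \<open>s k\<close> tends to 1.\<close>
    obtain i w b where w: "b \<in> Basis" "admissible E i w" "R < (real (length w) + 1) * norm (cword A w *v b)"
      using unbounded_growth[OF ng] by blast
    have "(\<lambda>k. (real (length w) + 1) * norm (cword A w *v b) / s k ^ length w)
       \<longlonglongrightarrow> (real (length w) + 1) * norm (cword A w *v b) / 1 ^ length w"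
      by (intro tendsto_intros s_lim) auto
    then have "eventually (\<lambda>k. R < (real (length w) + 1) * norm (cword A w *v b) / s k ^ length w) sequentially"
      using w(3) by (intro order_tendstoD) auto
    then show ?thesis
    proof eventually_elim
      case (elim k)
      then show ?case using growth_norm_ge[OF s[of k] w(2), of b] S_ge[OF w(1), of k i] by linarith
    qed
  qed
  define h where "h k p = growth_norm E A (s k) (fst p) (snd p) / S k" for k and p :: "'k \<times> (complex^'n)"
  have h_bound: "h k p \<le> norm (snd p)" for k p
  proof -
    have "growth_norm E A (s k) (fst p) (snd p) \<le> (\<Sum>b\<in>Basis. growth_norm E A (s k) (fst p) b) * norm (snd p)"
      by (rule cseminorm_le_sum_Basis[OF cseminorm_growth_norm[OF s]])
    also have "\<dots> \<le> S k * norm (snd p)"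
    proof (rule mult_right_mono)
      show "(\<Sum>b\<in>Basis. growth_norm E A (s k) (fst p) b) \<le> S k" unfolding S_def
        by (rule member_le_sum[of "fst p" UNIV "\<lambda>i. \<Sum>b\<in>Basis. growth_norm E A (s k) i b"])
          (auto intro: sum_nonneg nn)
    qed simp
    finally show ?thesis using S_pos[of k] by (simp add: h_def divide_le_eq mult.commute)
  qed
  have h_nonneg: "0 \<le> h k p" for k p using S_pos[of k] nn by (simp add: h_def)
  obtain g where g: "\<And>C. closed C \<Longrightarrow> eventually (\<lambda>k. h k \<in> C) sequentially \<Longrightarrow> g \<in> C"
    using cluster_function[of h "\<lambda>p. norm (snd p)"] h_bound h_nonneg by blast
  have ct: "continuous_on UNIV (\<lambda>h :: ('k \<times> (complex^'n)) \<Rightarrow> real. h p)" for p by simp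
  define N where "N i x = g (i, x)" for i x
  show ?thesis
  proof
    fix i
    have "N i (x + y) \<le> N i x + N i y" for x y
    proof -
      have "g \<in> {f. f (i, x + y) \<le> f (i, x) + f (i, y)}"
      proof (rule g)
        show "\<forall>\<^sub>F k in sequentially. h k \<in> {f. f (i, x + y) \<le> f (i, x) + f (i, y)}"
          using S_pos cseminorm_triangle[OF cseminorm_growth_norm[OF s]]
          by (simp add: h_def add_divide_distrib[symmetric] divide_right_mono less_imp_le)
      qed (intro closed_Collect_le continuous_on_add ct)
      then show ?thesis by (simp add: N_def)
    qed
    moreover have "N i (c *s x) = cmod c * N i x" for c x
    proof -
      have "g \<in> {f. f (i, c *s x) = cmod c * f (i, x)}"
      proof (rule g)
        show "\<forall>\<^sub>F k in sequentially. h k \<in> {f. f (i, c *s x) = cmod c * f (i, x)}"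
          by (simp add: h_def cseminorm_scale[OF cseminorm_growth_norm[OF s]])
      qed (intro closed_Collect_eq continuous_on_mult_left ct)
      then show ?thesis by (simp add: N_def)
    qed
    ultimately show "cseminorm (N i)" unfolding cseminorm_def by blast
  next
    fix i j x assume ij: "E i j"
    show "N j (A j *v x) \<le> N i x"
    \<comment> \<open>The inequality for \<open>h k\<close> carries the factor \<open>s k\<close>,
      which is eventually below \<open>1 / t\<close> for each fixed \<open>t < 1\<close>; that
      version is a closed condition and passes to the limit.\<close>
    proof (rule field_le_mult_one_interval)
      fix t :: real assume t: "0 < t" "t < 1"
      have "g \<in> {f. f (j, A j *v x) \<le> inverse t * f (i, x)}"
      proof (rule g)
        have "eventually (\<lambda>k. s k < inverse t) sequentially"
          using s_lim t by (intro order_tendstoD) (auto simp: one_less_inverse)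
        then show "\<forall>\<^sub>F k in sequentially. h k \<in> {f. f (j, A j *v x) \<le> inverse t * f (i, x)}"
        proof eventually_elim
          case (elim k)
          have "growth_norm E A (s k) j (A j *v x) \<le> s k * growth_norm E A (s k) i x"
            by (rule growth_norm_step[OF s ij])
          also have "\<dots> \<le> inverse t * growth_norm E A (s k) i x"
            using elim nn by (intro mult_right_mono) auto
          finally show ?case using S_pos[of k] by (simp add: h_def divide_right_mono)
        qed
      qed (intro closed_Collect_le continuous_on_mult_left ct)
      then show "t * N j (A j *v x) \<le> N i x" using t by (simp add: N_def field_simps)
    qed
  next
    fix i x assume pos: "0 < N i x"
    obtain K where K: "1 \<le> K" "\<And>j x. norm (A j *v x) \<le> K * norm x"
      using family_bound[of 1 A] by blast
    have ext: "N i x \<le> 1 / real m \<or> (\<exists>j. E i j \<and> N i x \<le> (1 + 1 / real m) * N j (A j *v x))" if m: "0 < m" for m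
    proof -
      \<comment> \<open>There are finitely many letters, so the disjunction over successors is a
        finite union of closed sets and is itself a closed condition.\<close>
      have "g \<in> {f. f (i, x) \<le> 1 / real m} \<union> (\<Union>j\<in>{j. E i j}. {f. f (i, x) \<le> (1 + 1 / real m) * f (j, A j *v x)})"
        (is "g \<in> ?C")
      proof (rule g)
        show "closed ?C"
          by (intro closed_Un closed_UN closed_Collect_le continuous_on_mult_left continuous_on_const ct ballI) auto
        \<comment> \<open>Once \<open>S k\<close> exceeds \<open>m\<close> times the short-word
          bound, the normalised contribution of short words is at most \<open>1 / m\<close>.\<close>
        have "eventually (\<lambda>k. m * (m * K ^ m * norm x) \<le> S k) sequentially" by (rule S_inf)
        then show "\<forall>\<^sub>F k in sequentially. h k \<in> ?C"
        proof eventually_elim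
          case (elim k)
          from growth_norm_extend[OF m K s, of k i x] show ?case
          proof
            assume "growth_norm E A (s k) i x \<le> m * K ^ m * norm x"
            then have "m * growth_norm E A (s k) i x \<le> m * (m * K ^ m * norm x)"
              by (intro mult_left_mono) auto
            then have "m * growth_norm E A (s k) i x \<le> S k" using elim by linarith
            then show ?case using m S_pos[of k] by (simp add: h_def field_simps)
          next
            assume "\<exists>j. E i j \<and> growth_norm E A (s k) i x \<le> (1 + 1 / real m) * growth_norm E A (s k) j (A j *v x)"
            then obtain j where j: "E i j"
              "growth_norm E A (s k) i x \<le> (1 + 1 / real m) * growth_norm E A (s k) j (A j *v x)" by blast
            have "h k (i, x) \<le> (1 + 1 / real m) * h k (j, A j *v x)"
              using divide_right_mono[OF j(2), of "S k"] S_pos[of k] by (simp add: h_def)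
            then show ?case using j(1) by auto
          qed
        qed
      qed
      then show ?thesis by (auto simp: N_def)
    qed
    \<comment> \<open>If every successor were strictly smaller, one large \<open>m\<close> would
      contradict \<open>ext\<close> for all letters at once. With no successor at all, the
      alternative \<open>1 / m\<close> fails alone.\<close>
    show "\<exists>j. E i j \<and> N i x \<le> N j (A j *v x)"
    proof (rule ccontr)
      assume "\<not> ?thesis"
      then have lt: "N j (A j *v x) < N i x" if "E i j" for j using that by force
      have lim: "(\<lambda>m. 1 / real m) \<longlonglongrightarrow> 0" by (rule lim_1_over_n)
      have "eventually (\<lambda>m. E i j \<longrightarrow> (1 + 1 / real m) * N j (A j *v x) < N i x) sequentially" for j
      proof (cases "E i j")
        case True
        have "(\<lambda>m. (1 + 1 / real m) * N j (A j *v x)) \<longlonglongrightarrow> (1 + 0) * N j (A j *v x)"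
          by (intro tendsto_intros lim)
        then have "eventually (\<lambda>m. (1 + 1 / real m) * N j (A j *v x) < N i x) sequentially"
          using lt[OF True] by (intro order_tendstoD) auto
        then show ?thesis by eventually_elim simp
      qed simp
      then have "eventually (\<lambda>m. \<forall>j. E i j \<longrightarrow> (1 + 1 / real m) * N j (A j *v x) < N i x) sequentially"
        by (rule eventually_all_finite)
      moreover have "eventually (\<lambda>m. 1 / real m < N i x) sequentially"
        using lim pos by (intro order_tendstoD) auto
      moreover have "eventually (\<lambda>m::nat. 0 < m) sequentially" by (rule eventually_gt_at_top)
      ultimately have "eventually (\<lambda>m::nat. False) sequentially"
      proof eventually_elim
        case (elim m)
        then show ?case using ext[of m] by force
      qed
      then show False by simp
    qed
  next
    have "g \<in> {f. (\<Sum>i\<in>UNIV. \<Sum>b\<in>Basis. f (i, b)) = 1}"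
    proof (rule g)
      show "\<forall>\<^sub>F k in sequentially. h k \<in> {f. (\<Sum>i\<in>UNIV. \<Sum>b\<in>Basis. f (i, b)) = 1}"
        using S_pos by (auto simp: h_def S_def simp flip: sum_divide_distrib intro!: always_eventually less_imp_neq[symmetric])
    qed (intro closed_Collect_eq continuous_on_sum continuous_on_const ct)
    then have "(\<Sum>i\<in>UNIV. \<Sum>b\<in>Basis. N i b) = 1" by (simp add: N_def)
    then show "\<exists>i x. 0 < N i x"
      by (smt (verit) sum_nonpos)
  qed
qed

end

subsection \<open>Recurrence along a norm-preserving path\<close>

text \<open>On the orthogonal complement \<open>W\<close> of its kernel, \<open>N\<close> is
  equivalent to the Euclidean norm. Replacing each \<open>X n\<close> by its component in
  \<open>W\<close> leaves \<open>N\<close> of differences unaffected and gives a bounded sequence,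
  so Bolzano-Weierstrass applies.\<close>

lemma cseminorm_recurrent:
  fixes X :: "nat \<Rightarrow> complex^'n"
  assumes N: "cseminorm N" and bnd: "\<And>n. N (X n) \<le> c" and S: "infinite S" and \<epsilon>: "0 < \<epsilon>"
  shows "\<exists>n\<in>S. \<exists>m\<in>S. n < m \<and> N (X m - X n) < \<epsilon>"
proof -
  define B where "B = (\<Sum>b\<in>Basis. N b) + 1"
  have B: "B > 0" "N x \<le> B * norm x" for x
    using cseminorm_le_sum_Basis[OF N, of x] cseminorm_nonneg[OF N]
    by (auto simp: B_def ring_distribs add_nonneg_pos sum_nonneg intro: order_trans)
  have cont: "continuous_on UNIV N"
  proof (rule lipschitz_on_continuous_on[of B], rule lipschitz_onI)
    fix x y
    have "N x \<le> N (x - y) + N y" "N y \<le> N (y - x) + N x"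
      using cseminorm_triangle[OF N, of "x - y" y] cseminorm_triangle[OF N, of "y - x" x] by auto
    then show "dist (N x) (N y) \<le> B * dist x y"
      using B(2)[of "x - y"] B(2)[of "y - x"] by (simp add: dist_norm norm_minus_commute abs_le_iff)
  qed (use B in simp)
  define Z where "Z = {x. N x = 0}"
  have sub: "subspace Z"
    unfolding subspace_def Z_def
    using cseminorm_0[OF N] cseminorm_scaleR[OF N] cseminorm_triangle[OF N] cseminorm_nonneg[OF N]
    by (auto intro!: antisym) (metis add_0)
  define W where "W = {z. \<forall>w\<in>Z. orthogonal z w}"
  have W_decomp: "\<exists>u\<in>W. N (x - u) = 0" for x
  proof -
    have Z: "span Z = Z" using sub by (simp add: span_eq_iff)
    obtain y z where yz: "y \<in> span Z" "\<And>w. w \<in> span Z \<Longrightarrow> orthogonal z w" "x = y + z"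
      using orthogonal_subspace_decomp_exists[of Z x] by blast
    have "N y = 0" using yz(1) unfolding Z by (simp add: Z_def)
    moreover have "z \<in> W" using yz(2) unfolding Z by (simp add: W_def)
    ultimately show ?thesis using yz(3) by (intro bexI[of _ z]) auto
  qed
  have "closed W"
  proof -
    have "W = (\<Inter>w\<in>Z. {z. z \<bullet> w = 0})" by (auto simp: W_def orthogonal_def)
    then show ?thesis by (auto intro!: closed_INT closed_Collect_eq continuous_intros)
  qed
  then have cmp: "compact (sphere 0 1 \<inter> W)" by (intro compact_Int_closed) auto
  have W_pos: "0 < N z" if "z \<in> W" "z \<noteq> 0" for z
  proof -
    have "z \<notin> Z" using that by (auto simp: W_def orthogonal_def)
    then show ?thesis using cseminorm_nonneg[OF N, of z] by (simp add: Z_def)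
  qed
  \<comment> \<open>The minimum of \<open>N\<close> on the unit sphere of \<open>W\<close>; if
    \<open>W\<close> is trivial, any positive constant serves.\<close>
  obtain c' where c': "c' > 0" "\<And>z. z \<in> sphere 0 1 \<inter> W \<Longrightarrow> c' \<le> N z"
  proof (cases "sphere 0 1 \<inter> W = {}")
    case True
    then show ?thesis using that[of 1] by auto
  next
    case False
    then obtain z0 where z0: "z0 \<in> sphere 0 1 \<inter> W" "\<And>z. z \<in> sphere 0 1 \<inter> W \<Longrightarrow> N z0 \<le> N z"
      using continuous_attains_inf[OF cmp False] continuous_on_subset[OF cont] by blast
    moreover have "z0 \<noteq> 0" using z0(1) by auto
    ultimately show ?thesis using that[of "N z0"] W_pos[of z0] by blast
  qed
  have W_bound: "c' * norm z \<le> N z" if z: "z \<in> W" for z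
  proof (cases "z = 0")
    case False
    have "(1 / norm z) *\<^sub>R z \<in> sphere 0 1 \<inter> W"
      using z False by (auto simp: W_def orthogonal_def)
    then have "c' \<le> N ((1 / norm z) *\<^sub>R z)" by (rule c')
    then show ?thesis using False by (simp add: cseminorm_scaleR[OF N] field_simps)
  qed (simp add: cseminorm_0[OF N])
  obtain U where U: "\<And>n. U n \<in> W" "\<And>n. N (X n - U n) = 0"
    using W_decomp[of "X _"] by metis
  have U_norm: "norm (U n) \<le> c / c'" for n
  proof -
    have "N (U n) \<le> N (X n) + N (X n - U n)" using cseminorm_diff[OF N, of "X n" "X n - U n"] by simp
    then have "c' * norm (U n) \<le> c" using W_bound[OF U(1)[of n]] U(2)[of n] bnd[of n] by linarith
    then show ?thesis using c' by (simp add: field_simps)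
  qed
  have "seq_compact (cball (0 :: complex^'n) (c / c'))" by (intro compact_imp_seq_compact compact_cball)
  \<comment> \<open>Enumerating \<open>S\<close> before extracting the subsequence keeps both chosen
    indices in \<open>S\<close>.\<close>
  then obtain l r where r: "strict_mono r" "((\<lambda>n. U (enumerate S n)) \<circ> r) \<longlonglongrightarrow> l"
    using U_norm unfolding seq_compact_def by (metis dist_0_norm mem_cball)
  have "Cauchy ((\<lambda>n. U (enumerate S n)) \<circ> r)" using r(2) by (rule LIMSEQ_imp_Cauchy)
  then obtain M where M: "\<And>m n. m \<ge> M \<Longrightarrow> n \<ge> M \<Longrightarrow> dist (U (enumerate S (r m))) (U (enumerate S (r n))) < \<epsilon> / B"
    using \<epsilon> B(1) unfolding Cauchy_def by (metis divide_pos_pos o_apply)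
  define n m where "n = enumerate S (r M)" and "m = enumerate S (r (Suc M))"
  have "n < m" unfolding n_def m_def using r(1) S by (intro enumerate_mono) (auto simp: strict_mono_def)
  moreover have "N (X m - X n) < \<epsilon>"
  proof -
    have "X m - X n = (X m - U m) + ((U m - U n) - (X n - U n))" by simp
    then have "N (X m - X n) \<le> N (X m - U m) + (N (U m - U n) + N (X n - U n))"
      using cseminorm_triangle[OF N] cseminorm_diff[OF N] by (metis add_left_mono order_trans)
    also have "\<dots> \<le> B * norm (U m - U n)" using U(2) B(2) by simp
    also have "\<dots> < \<epsilon>" using M[of "Suc M" M] B(1) by (simp add: n_def m_def dist_norm field_simps)
    finally show ?thesis .
  qed
  moreover have "n \<in> S" "m \<in> S" using S by (auto simp: n_def m_def intro: enumerate_in_set)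
  ultimately show ?thesis by blast
qed

text \<open>At joint growth rate 1, a recurrence along a path of constant seminorm produces a
  periodic word with an approximate eigenvector for 1. This contradicts eigenvalues bounded by
  \<theta> < 1 uniformly in the word.\<close>

lemma no_uniform_spectral_gap_at_growth_rate:
  fixes E :: "'k::finite \<Rightarrow> 'k \<Rightarrow> bool" and A :: "'k \<Rightarrow> complex^'n^'n"
  assumes growth: "\<And>s. 1 < s \<Longrightarrow> growth_bound E A s"
    and no_growth: "\<And>q. 0 < q \<Longrightarrow> q < 1 \<Longrightarrow> \<not> growth_bound E A q"
    and eig: "\<And>w \<mu>. w \<noteq> [] \<Longrightarrow> admissible E (last w) w \<Longrightarrow> \<mu> \<in> eigenvalues (cword A w) \<Longrightarrow> cmod \<mu> \<le> \<theta>"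
    and \<theta>: "\<theta> < 1"
  shows False
proof -
  obtain N :: "'k \<Rightarrow> complex^'n \<Rightarrow> real" where N: "\<And>i. cseminorm (N i)"
    and step: "\<And>i j x. E i j \<Longrightarrow> N j (A j *v x) \<le> N i x"
    and ext: "\<And>i x. 0 < N i x \<Longrightarrow> \<exists>j. E i j \<and> N i x \<le> N j (A j *v x)"
    and pos: "\<exists>i x. 0 < N i x"
    using barabanov_seminorm[OF growth no_growth] by blast
  obtain i0 x0 where x0: "0 < N i0 x0" using pos by blast
  define c where "c = N i0 x0"
  define J where "J i x = (SOME j. E i j \<and> N i x \<le> N j (A j *v x))" for i x
  have J: "E i (J i x) \<and> N i x \<le> N (J i x) (A (J i x) *v x)" if "0 < N i x" for i x
    unfolding J_def using ext[OF that] by (rule someI_ex)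
  define P where "P n = ((\<lambda>(i, x). (J i x, A (J i x) *v x)) ^^ n) (i0, x0)" for n
  define I X where "I n = fst (P n)" and "X n = snd (P n)" for n
  have orbit: "I (Suc n) = J (I n) (X n)" "X (Suc n) = A (I (Suc n)) *v X n" for n
    by (simp_all add: I_def X_def P_def case_prod_beta)
  have NX: "N (I n) (X n) = c" for n
  proof (induction n)
    case 0
    show ?case by (simp add: I_def X_def P_def c_def)
  next
    case (Suc n)
    then have "0 < N (I n) (X n)" using x0 c_def by simp
    \<comment> \<open>The choice of \<open>J\<close> gives one inequality and the contraction
      \<open>step\<close> the other, so the seminorm stays exactly constant.\<close>
    from J[OF this] step[of "I n" "I (Suc n)" "X n"] show ?case
      using Suc.IH by (simp add: orbit)
  qed
  have edge: "E (I n) (I (Suc n))" for n using J[of "I n" "X n"] NX[of n] x0 c_def by (simp add: orbit)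
  have walk: "\<exists>w. length w = k \<and> admissible E (I n) w \<and> last (I n # w) = I (n + k) \<and> X (n + k) = cword A w *v X n" for n k
  proof (induction k)
    case 0
    show ?case by (intro exI[of _ "[]"]) simp
  next
    case (Suc k)
    then obtain w where w: "length w = k" "admissible E (I n) w" "last (I n # w) = I (n + k)"
      "X (n + k) = cword A w *v X n" by blast
    let ?j = "I (Suc (n + k))"
    have "cword A (w @ [?j]) *v X n = A ?j *v X (n + k)"
      by (simp add: cword_append_apply cword_Cons_apply w(4) del: cword.simps)
    then show ?case using w edge[of "n + k"]
      by (intro exI[of _ "w @ [?j]"]) (auto simp: admissible_append orbit(2))
  qed
  have N_word: "N (last (i # w)) (cword A w *v x) \<le> N i x" if "admissible E i w" for i w x
    using that
  proof (induction w arbitrary: i x)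
    case (Cons j w)
    then have "N (last (j # w)) (cword A w *v (A j *v x)) \<le> N j (A j *v x)" by auto
    also have "\<dots> \<le> N i x" using Cons.prems step by auto
    finally show ?case by (simp add: cword_Cons_apply del: cword.simps)
  qed simp
  define D where "D = DIM(complex^'n^'n)"
  have D: "D > 0" unfolding D_def by (rule DIM_positive)
  \<comment> \<open>Chosen to contradict \<open>approximate_eigenvector_bound\<close> with
    \<open>m = 1\<close> and \<alpha> = 1, for which \<open>L = 3\<close>.\<close>
  define \<epsilon> where "\<epsilon> = ((1 - \<theta>) / 3) ^ D * c / D"
  have \<epsilon>: "\<epsilon> > 0" using \<theta> x0 D by (simp add: \<epsilon>_def c_def)
  obtain n0 where n0: "infinite {n. I n = I n0}"
    using pigeonhole_infinite[of UNIV I] by auto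
  \<comment> \<open>The seminorm of the recurring letter controls \<open>X n\<close> only at times
    when that letter is current; 0 elsewhere keeps the sequence bounded.\<close>
  define Y where "Y n = (if I n = I n0 then X n else 0)" for n
  have "N (I n0) (Y n) \<le> c" for n
    using NX[of n] x0 by (auto simp: Y_def cseminorm_0[OF N] c_def)
  from cseminorm_recurrent[where X = Y, OF N this n0 \<epsilon>] obtain n m where
    nm: "I n = I n0" "I m = I n0" "n < m" "N (I n0) (X m - X n) < \<epsilon>" by (auto simp: Y_def)
  obtain w where w: "length w = m - n" "admissible E (I n) w" "last (I n # w) = I m" "X m = cword A w *v X n"
    using walk[of "m - n" n] nm(3) by auto
  have w_ne: "w \<noteq> []" using w(1) nm(3) by auto
  \<comment> \<open>The word ends in the letter it follows, so it may follow itself and is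
    periodic.\<close>
  have last: "last w = I n" using w(3) w_ne nm by simp
  have "((cmod 1 - \<theta>) / 3) ^ D * N (I n) (X n) \<le> D * N (I n) (cword A w *v X n - 1 *s X n)"
    unfolding D_def
  proof (rule approximate_eigenvector_bound[OF N, where m = 1])
    show "N (I n) (cword A w *v x) \<le> 1 * N (I n) x" for x
      using N_word[OF w(2), of x] w_ne last by simp
    show "cmod \<mu> \<le> \<theta>" if "\<mu> \<in> eigenvalues (cword A w)" for \<mu>
      using eig[OF w_ne _ that] last w(2) by simp
  qed (use \<theta> in auto)
  then have "((1 - \<theta>) / 3) ^ D * c \<le> D * N (I n) (X m - X n)" by (simp add: NX w(4))
  also have "\<dots> < D * \<epsilon>" using nm D by simp
  also have "\<dots> = ((1 - \<theta>) / 3) ^ D * c" using D by (simp add: \<epsilon>_def)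
  finally show False by simp
qed

section \<open>The constrained Berger-Wang theorem by scaling\<close>

lemma ex_growth_bound:
  fixes A :: "'k::finite \<Rightarrow> complex^'n^'n"
  obtains K where "1 \<le> K" "growth_bound E A K"
proof -
  obtain K where K: "1 \<le> K" "\<And>j x. norm (A j *v x) \<le> K * norm x" using family_bound[of 1 A] by blast
  have "growth_bound E A K"
    unfolding growth_bound_def
    using cword_norm_le_power[of A K, OF K(2)] K(1) by (intro exI[of _ 1]) auto
  then show ?thesis using that K(1) by blast
qed

lemma growth_bound_scale:
  assumes c: "0 < c"
  shows "growth_bound E (\<lambda>j. c *\<^sub>R A j) (c * s) \<longleftrightarrow> growth_bound E A s"
proof -
  have "norm (cword (\<lambda>j. c *\<^sub>R A j) w *v x) \<le> C * (c * s) ^ length w * norm x \<longleftrightarrow>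
     norm (cword A w *v x) \<le> C * s ^ length w * norm x" for C w x
  proof -
    have "norm (cword (\<lambda>j. c *\<^sub>R A j) w *v x) = c ^ length w * norm (cword A w *v x)"
      using c by (simp add: cword_scale_apply)
    moreover have "C * (c * s) ^ length w * norm x = c ^ length w * (C * s ^ length w * norm x)"
      by (simp only: power_mult_distrib mult_ac)
    ultimately show ?thesis
      using c by (simp only: mult_le_cancel_left_pos zero_less_power)
  qed
  then show ?thesis unfolding growth_bound_def by simp
qed

text \<open>The Berger--Wang theorem for words constrained by the relation \<open>E\<close>.\<close>

theorem growth_bound_of_periodic_eigenvalues:
  fixes E :: "'k::finite \<Rightarrow> 'k \<Rightarrow> bool" and A :: "'k \<Rightarrow> complex^'n^'n"
  assumes eig: "\<And>w \<mu>. w \<noteq> [] \<Longrightarrow> admissible E (last w) w \<Longrightarrow> \<mu> \<in> eigenvalues (cword A w) \<Longrightarrow>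
      cmod \<mu> \<le> \<theta> ^ length w"
    and \<theta>: "0 \<le> \<theta>" "\<theta> < s"
  shows "growth_bound E A s"
proof (rule ccontr)
  assume no: "\<not> growth_bound E A s"
  define R where "R = {q. 0 < q \<and> growth_bound E A q}"
  obtain K where K: "1 \<le> K" "growth_bound E A K" by (rule ex_growth_bound)
  then have "K \<in> R" by (simp add: R_def)
  then have R_ne: "R \<noteq> {}" by blast
  have R_ge: "s \<le> q" if "q \<in> R" for q
    using that no growth_bound_mono[of E A q s] by (force simp: R_def)
  have bdd: "bdd_below R" using R_ge by (rule bdd_belowI)
  \<comment> \<open>This is the joint growth rate. It is at least \<open>s\<close>, hence positive
    and above \<theta>, so the family can be scaled to growth rate 1.\<close>
  define r where "r = Inf R"
  have "s \<le> r" unfolding r_def using R_ne R_ge by (rule cInf_greatest)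
  then have r: "0 < r" "\<theta> < r" using \<theta> by auto
  define B where "B = (\<lambda>j. (1 / r) *\<^sub>R A j)"
  have scale: "growth_bound E B q \<longleftrightarrow> growth_bound E A (r * q)" for q
    using growth_bound_scale[of "1 / r" E A "r * q"] r(1) by (simp add: B_def)
  show False
  proof (rule no_uniform_spectral_gap_at_growth_rate[of E B "\<theta> / r"])
    fix q :: real assume "1 < q"
    then have "Inf R < r * q" using r by (simp add: r_def)
    then obtain t where "t \<in> R" "t < r * q" using cInf_lessD[OF R_ne] by blast
    then show "growth_bound E B q"
      unfolding scale using growth_bound_mono[of E A t "r * q"] by (auto simp: R_def)
  next
    fix q :: real assume q: "0 < q" "q < 1"
    then have "r * q \<notin> R" using cInf_lower[OF _ bdd, of "r * q"] r by (auto simp: r_def)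
    then show "\<not> growth_bound E B q" unfolding scale using q r by (simp add: R_def)
  next
    fix w \<mu> assume w: "w \<noteq> []" "admissible E (last w) w" "\<mu> \<in> eigenvalues (cword B w)"
    let ?n = "length w"
    obtain v where v: "v \<noteq> 0" "cword B w *v v = \<mu> *s v" using w(3) by (auto simp: eigenvalues_def)
    have "cword A w *v v = (r ^ ?n) *\<^sub>R (cword B w *v v)"
      using r by (simp add: B_def cword_scale_apply power_one_over)
    also have "\<dots> = (complex_of_real (r ^ ?n) * \<mu>) *s v"
      by (simp only: v(2) vector_smult_of_real[symmetric] vec.scale_scale)
    finally have "complex_of_real (r ^ ?n) * \<mu> \<in> eigenvalues (cword A w)"
      using v(1) by (auto simp: eigenvalues_def)
    from eig[OF w(1,2) this] have "r ^ ?n * cmod \<mu> \<le> \<theta> ^ ?n"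
      using r by (simp add: norm_mult norm_power)
    then have "cmod \<mu> \<le> (\<theta> / r) ^ ?n" using r by (simp add: power_divide field_simps)
    \<comment> \<open>A periodic word has length at least 1 and \<theta> / r < 1, so the
      length-dependent bound yields one gap for all words.\<close>
    also have "\<dots> \<le> (\<theta> / r) ^ 1"
      using w(1) r \<theta> by (intro power_decreasing) (auto simp: Suc_leI)
    finally show "cmod \<mu> \<le> \<theta> / r" by simp
  next
    show "\<theta> / r < 1" using r by simp
  qed
qed

section \<open>Semicontinuity\<close>

lemma tendsto_matrix_vector_mult:
  fixes M :: "'a \<Rightarrow> complex^'n^'m"
  assumes "(M \<longlongrightarrow> M0) F" "(x \<longlongrightarrow> x0) F"
  shows "((\<lambda>a. M a *v x a) \<longlongrightarrow> M0 *v x0) F"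
  unfolding matrix_vector_mult_def
  by (intro vec_tendstoI) (auto intro!: tendsto_sum tendsto_mult tendsto_vec_nth assms)

lemma tendsto_cword:
  fixes M :: "'a \<Rightarrow> 'k \<Rightarrow> complex^'n^'n"
  assumes "\<And>j. ((\<lambda>a. M a j) \<longlongrightarrow> M0 j) F" "(x \<longlongrightarrow> x0) F"
  shows "((\<lambda>a. cword (M a) w *v x a) \<longlongrightarrow> cword M0 w *v x0) F"
  using assms(2)
proof (induction w arbitrary: x x0)
  case (Cons j w)
  show ?case unfolding cword_Cons_apply
    by (intro Cons.IH tendsto_matrix_vector_mult assms(1) Cons.prems)
qed (simp del: cword.simps)

text \<open>An eigenvector of \<open>M0\<close> for \<alpha> is an approximate eigenvector of every
  nearby \<open>M a\<close>; if all eigenvalues of \<open>M a\<close> had modulus at most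
  \<open>t\<close>, its residual would be bounded away from 0.\<close>

lemma eventually_eigenvalue_gt:
  fixes M :: "'a \<Rightarrow> complex^'n^'n"
  assumes lim: "\<And>x. ((\<lambda>a. M a *v x) \<longlongrightarrow> M0 *v x) F" and \<alpha>: "\<alpha> \<in> eigenvalues M0" "t < cmod \<alpha>"
  shows "\<forall>\<^sub>F a in F. \<exists>\<mu>\<in>eigenvalues (M a). t < cmod \<mu>"
proof -
  obtain v where v: "v \<noteq> 0" "M0 *v v = \<alpha> *s v" using \<alpha> by (auto simp: eigenvalues_def)
  \<comment> \<open>The slack 1 makes \<open>m\<close> an operator bound for all nearby matrices, so
    that \<open>L\<close> does not depend on \<open>a\<close>.\<close>
  define m where "m = (\<Sum>b\<in>Basis. norm (M0 *v b)) + 1"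
  define D L where "D = DIM(complex^'n^'n)" and "L = 1 + m + cmod \<alpha>"
  have m: "0 \<le> m" unfolding m_def by (intro add_nonneg_nonneg sum_nonneg) auto
  have "((\<lambda>a. \<Sum>b\<in>Basis. norm (M a *v b)) \<longlongrightarrow> (\<Sum>b\<in>Basis. norm (M0 *v b))) F"
    by (intro tendsto_intros lim)
  then have ev_m: "\<forall>\<^sub>F a in F. (\<Sum>b\<in>Basis. norm (M a *v b)) < m"
    by (rule order_tendstoD) (simp add: m_def)
  have "((\<lambda>a. D * norm (M a *v v - \<alpha> *s v)) \<longlongrightarrow> D * norm (M0 *v v - \<alpha> *s v)) F"
    by (intro tendsto_intros lim)
  moreover have "0 < ((cmod \<alpha> - t) / L) ^ D * norm v"
    using \<alpha> m v unfolding L_def by (intro mult_pos_pos zero_less_power divide_pos_pos) (auto intro: add_pos_nonneg)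
  ultimately have "\<forall>\<^sub>F a in F. D * norm (M a *v v - \<alpha> *s v) < ((cmod \<alpha> - t) / L) ^ D * norm v"
    using v(2) by (intro order_tendstoD) auto
  with ev_m show ?thesis
  proof eventually_elim
    case (elim a)
    show ?case
    proof (rule ccontr)
      assume no: "\<not> ?thesis"
      have "norm (M a *v x) \<le> m * norm x" for x
        using norm_linear_le_sum_Basis[OF linear_matrix_vector_mult, of "M a" x] elim(1)
        by (meson less_imp_le mult_right_mono norm_ge_zero order_trans)
      then have "((cmod \<alpha> - t) / L) ^ D * norm v \<le> D * norm (M a *v v - \<alpha> *s v)"
        unfolding D_def using no \<alpha> m L_def
        by (intro approximate_eigenvector_bound[OF cseminorm_norm]) (auto simp: not_less)
      then show False using elim(2) by simp
    qed
  qed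
qed

subsection \<open>Real matrices\<close>

abbreviation complexify :: "real^'n^'m \<Rightarrow> complex^'n^'m" where
  "complexify \<equiv> map_matrix complex_of_real"

abbreviation transition :: "nat^'k^'k \<Rightarrow> 'k \<Rightarrow> 'k \<Rightarrow> bool" where
  "transition T i j \<equiv> T $ i $ j = 1"

lemma complexify_matrix_mult: "complexify (M ** N) = complexify M ** complexify N"
  by (simp add: map_matrix_def matrix_matrix_mult_def vec_eq_iff)

lemma complexify_word_product:
  "complexify (word_product A w) = cword (\<lambda>i. complexify (A $ i)) w"
proof (induction w)
  case Nil
  show ?case by (simp add: map_matrix_def mat_def vec_eq_iff)
qed (simp add: complexify_matrix_mult)

lemma tendsto_complexify:
  assumes "(M \<longlongrightarrow> M0) F"
  shows "((\<lambda>a. complexify (M a)) \<longlongrightarrow> complexify M0) F"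
  unfolding map_matrix_def
  by (intro vec_tendstoI) (auto intro!: tendsto_of_real tendsto_vec_nth assms)

lemma complex_eigenvalues_eq: "complex_eigenvalues B = eigenvalues (complexify B)"
  by (simp add: complex_eigenvalues_def eigenvalues_def)

lemma eigenvalue_le_spectral_radius:
  "\<mu> \<in> eigenvalues (complexify B) \<Longrightarrow> cmod \<mu> \<le> matrix_spectral_radius B"
  by (simp add: matrix_spectral_radius_def complex_eigenvalues_eq finite_eigenvalues)

lemma spectral_radius_attained:
  obtains \<mu> where "\<mu> \<in> eigenvalues (complexify B)" "matrix_spectral_radius B = cmod \<mu>"
proof -
  have "Max (cmod ` eigenvalues (complexify B)) \<in> cmod ` eigenvalues (complexify B)"
    by (intro Max_in) (auto simp: finite_eigenvalues eigenvalues_nonempty)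
  then show ?thesis using that by (auto simp: matrix_spectral_radius_def complex_eigenvalues_eq)
qed

lemma spectral_radius_nonneg: "0 \<le> matrix_spectral_radius B"
  using spectral_radius_attained[of B] by (metis norm_ge_zero)

lemma spectral_radius_le:
  assumes "\<And>x. norm (complexify B *v x) \<le> c * norm x"
  shows "matrix_spectral_radius B \<le> c"
proof -
  obtain \<mu> where \<mu>: "\<mu> \<in> eigenvalues (complexify B)" "matrix_spectral_radius B = cmod \<mu>"
    by (rule spectral_radius_attained)
  then obtain v where v: "v \<noteq> 0" "complexify B *v v = \<mu> *s v" by (auto simp: eigenvalues_def)
  have "cmod \<mu> * norm v \<le> c * norm v"
    using assms[of v] v(2) by (simp add: cseminorm_scale[OF cseminorm_norm])
  then show ?thesis using v(1) \<mu>(2) by simp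
qed

lemma eventually_spectral_radius_gt:
  assumes "t < matrix_spectral_radius (word_product A0 w)"
  shows "\<forall>\<^sub>F A in nhds A0. t < matrix_spectral_radius (word_product A w)"
proof -
  obtain \<alpha> where \<alpha>: "\<alpha> \<in> eigenvalues (complexify (word_product A0 w))" "t < cmod \<alpha>"
    using assms spectral_radius_attained by metis
  have "((\<lambda>A. complexify (A $ j)) \<longlongrightarrow> complexify (A0 $ j)) (nhds A0)" for j
    by (intro tendsto_complexify tendsto_vec_nth filterlim_ident)
  then have "\<forall>\<^sub>F A in nhds A0. \<exists>\<mu>\<in>eigenvalues (complexify (word_product A w)). t < cmod \<mu>"
    using \<alpha> unfolding complexify_word_product
    by (intro eventually_eigenvalue_gt[OF tendsto_cword]) auto
  then show ?thesis
    by eventually_elim (meson eigenvalue_le_spectral_radius less_le_trans)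
qed

text \<open>Fix \<open>n\<close> so large that the products at \<open>A0\<close> have norm at most
  half of \<open>q ^ n\<close>. There are finitely many words of length \<open>n\<close>, so a small
  perturbation changes them by less than the other half, and one length determines the growth
  bound.\<close>

lemma eventually_growth_bound:
  fixes A0 :: "(real^'d^'d)^'k"
  assumes growth: "growth_bound E (\<lambda>i. complexify (A0 $ i)) p" and p: "0 < p" "p < q"
  shows "\<forall>\<^sub>F A in nhds A0. growth_bound E (\<lambda>i. complexify (A $ i)) q"
proof -
  define M where "M A = (\<lambda>i. complexify (A $ i))" for A :: "(real^'d^'d)^'k"
  obtain C where C: "C \<ge> 0" "\<And>i w x. admissible E i w \<Longrightarrow> norm (cword (M A0) w *v x) \<le> C * p ^ length w * norm x"
    using growth unfolding growth_bound_def M_def by blast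
  have "(\<lambda>n. C * (p / q) ^ n) \<longlonglongrightarrow> C * 0"
    using p by (intro tendsto_intros LIMSEQ_power_zero) auto
  then have "\<forall>\<^sub>F n in sequentially. C * (p / q) ^ n < 1 / 2" by (intro order_tendstoD) auto
  moreover have "\<forall>\<^sub>F n::nat in sequentially. 0 < n" by (rule eventually_gt_at_top)
  ultimately have "\<forall>\<^sub>F n in sequentially. C * (p / q) ^ n < 1 / 2 \<and> 0 < n" by (rule eventually_conj)
  then obtain n :: nat where n: "C * (p / q) ^ n < 1 / 2" "0 < n"
    using eventually_happens[of _ sequentially] by auto
  have Cn: "C * p ^ n \<le> q ^ n / 2" using n(1) p by (simp add: power_divide field_simps)
  define W where "W = {w :: 'k list. set w \<subseteq> UNIV \<and> length w = n}"
  have W: "finite W" unfolding W_def by (intro finite_lists_length_eq) simp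
  have "\<forall>\<^sub>F A in nhds A0. \<forall>w\<in>W. (\<Sum>b\<in>Basis. norm (cword (M A) w *v b - cword (M A0) w *v b)) < q ^ n / 2"
  proof (intro eventually_ball_finite W ballI)
    fix w
    have "((\<lambda>A. M A j) \<longlongrightarrow> M A0 j) (nhds A0)" for j
      unfolding M_def by (intro tendsto_complexify tendsto_vec_nth filterlim_ident)
    then have "((\<lambda>A. \<Sum>b\<in>Basis. norm (cword (M A) w *v b - cword (M A0) w *v b))
        \<longlongrightarrow> (\<Sum>b\<in>Basis. norm (cword (M A0) w *v b - cword (M A0) w *v b))) (nhds A0)"
      by (intro tendsto_intros tendsto_cword)
    then show "\<forall>\<^sub>F A in nhds A0. (\<Sum>b\<in>Basis. norm (cword (M A) w *v b - cword (M A0) w *v b)) < q ^ n / 2"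
      using p by (intro order_tendstoD) auto
  qed
  then show ?thesis unfolding M_def[symmetric]
  proof eventually_elim
    case (elim A)
    show ?case
    proof (rule growth_boundI[OF n(2)])
      fix i w and x :: "complex^'d" assume w: "admissible E i w" "length w = n"
      have "linear (\<lambda>x. cword (M A) w *v x - cword (M A0) w *v x)"
        by (intro linear_compose_sub linear_matrix_vector_mult)
      then have "norm (cword (M A) w *v x - cword (M A0) w *v x)
          \<le> (\<Sum>b\<in>Basis. norm (cword (M A) w *v b - cword (M A0) w *v b)) * norm x"
        by (rule norm_linear_le_sum_Basis)
      also have "\<dots> \<le> q ^ n / 2 * norm x"
        using elim w(2) by (intro mult_right_mono) (auto simp: W_def less_imp_le)
      finally have 1: "norm (cword (M A) w *v x - cword (M A0) w *v x) \<le> q ^ n / 2 * norm x" .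
      have "norm (cword (M A0) w *v x) \<le> q ^ n / 2 * norm x"
        using C(2)[OF w(1), of x] mult_right_mono[OF Cn, of "norm x"] w(2) by simp
      with 1 show "norm (cword (M A) w *v x) \<le> q ^ n * norm x"
        using norm_triangle_sub[of "cword (M A) w *v x" "cword (M A0) w *v x"] by simp
    qed (use p in simp)
  qed
qed

subsection \<open>The constrained spectral radius\<close>

lemma admissible_iff_nth: "admissible E i w \<longleftrightarrow> (\<forall>k<length w. E ((i # w) ! k) (w ! k))"
proof (induction w arbitrary: i)
  case (Cons j w)
  show ?case by (simp add: Cons All_less_Suc2)
qed simp

text \<open>The closing transition from the last letter to the first becomes the first condition of
  admissibility after \<open>last w\<close>.\<close>

lemma mem_periodic_words_iff:
  assumes "w \<noteq> []"
  shows "w \<in> periodic_words T n \<longleftrightarrow> length w = n \<and> admissible (transition T) (last w) w"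
proof -
  obtain m where m: "length w = Suc m" using assms by (cases w) auto
  show ?thesis
    using assms m by (auto simp: periodic_words_def admissible_iff_nth All_less_Suc2 last_conv_nth)
qed

lemma finite_periodic_words: "finite (periodic_words T n)"
  by (rule finite_subset[OF _ finite_lists_length_eq[of UNIV n]]) (auto simp: periodic_words_def)

lemma max_periodic_radius_ge:
  assumes "w \<in> periodic_words T n"
  shows "root n (matrix_spectral_radius (word_product A w)) \<le> max_periodic_radius A T n"
  using assms finite_periodic_words[of T n] by (auto simp: max_periodic_radius_def)

lemma max_periodic_radius_nonneg: "0 \<le> max_periodic_radius A T n"
proof (cases "periodic_words T n = {}")
  case False
  then obtain w where "w \<in> periodic_words T n" by blast
  from max_periodic_radius_ge[OF this, of A] show ?thesis
    by (rule order_trans[rotated]) (simp add: real_root_ge_zero spectral_radius_nonneg)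
qed (simp add: max_periodic_radius_def)

text \<open>Spectral radii are bounded by operator norms, and the \<open>n\<close>-th root of the
  constant tends to 1.\<close>

lemma limsup_le_growth_bound:
  assumes "growth_bound (transition T) (\<lambda>i. complexify (A $ i)) s" "0 < s"
  shows "limsup (\<lambda>n. ereal (max_periodic_radius A T n)) \<le> ereal s"
proof -
  obtain C where C: "\<And>i w x. admissible (transition T) i w \<Longrightarrow>
      norm (cword (\<lambda>i. complexify (A $ i)) w *v x) \<le> C * s ^ length w * norm x"
    using assms(1) unfolding growth_bound_def by blast
  \<comment> \<open>\<open>C\<close> may be 0, whereas the roots tend to 1 only for a positive
    constant.\<close>
  define c where "c = max C 1"
  have "max_periodic_radius A T n \<le> root n c * s" if n: "0 < n" for n
  proof (cases "periodic_words T n = {}")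
    case True
    then show ?thesis using assms(2) by (simp add: max_periodic_radius_def c_def n real_root_ge_zero)
  next
    case False
    have "root n (matrix_spectral_radius (word_product A w)) \<le> root n c * s" if w: "w \<in> periodic_words T n" for w
    proof -
      have "length w = n" using w by (simp add: periodic_words_def)
      then have adm: "admissible (transition T) (last w) w" "length w = n"
        using w n mem_periodic_words_iff[of w T n] by auto
      have "matrix_spectral_radius (word_product A w) \<le> C * s ^ n"
        using C[OF adm(1)] adm(2) by (intro spectral_radius_le) (simp add: complexify_word_product)
      also have "\<dots> \<le> c * s ^ n" using assms(2) by (intro mult_right_mono) (auto simp: c_def)
      finally have "root n (matrix_spectral_radius (word_product A w)) \<le> root n (c * s ^ n)"
        using n by simp
      also have "\<dots> = root n c * s" using n assms(2) by (simp add: real_root_mult real_root_power_cancel)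
      finally show ?thesis .
    qed
    then show ?thesis using False finite_periodic_words[of T n] by (simp add: max_periodic_radius_def)
  qed
  then have "\<forall>\<^sub>F n in sequentially. ereal (max_periodic_radius A T n) \<le> ereal (root n c * s)"
    by (intro eventually_mono[OF eventually_gt_at_top[of 0]]) simp
  then have "limsup (\<lambda>n. ereal (max_periodic_radius A T n)) \<le> limsup (\<lambda>n. ereal (root n c * s))"
    by (rule Limsup_mono)
  also have "(\<lambda>n. root n c * s) \<longlonglongrightarrow> 1 * s"
    by (intro tendsto_intros LIMSEQ_root_const) (simp add: c_def)
  then have "limsup (\<lambda>n. ereal (root n c * s)) = ereal s"
    by (intro lim_imp_Limsup) auto
  finally show ?thesis .
qed

text \<open>The upper limit lies between 0 and a finite growth rate, so \<open>real_of_ereal\<close>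
  loses no information.\<close>

lemma limsup_eq_constrained_spectral_radius:
  "limsup (\<lambda>n. ereal (max_periodic_radius A T n)) = ereal (constrained_spectral_radius A T)"
  and constrained_spectral_radius_nonneg: "0 \<le> constrained_spectral_radius A T"
proof -
  let ?L = "limsup (\<lambda>n. ereal (max_periodic_radius A T n))"
  let ?A = "\<lambda>i. complexify (A $ i)"
  obtain K where K: "1 \<le> K" "growth_bound (transition T) ?A K" by (rule ex_growth_bound)
  then have le: "?L \<le> ereal K" using K by (intro limsup_le_growth_bound) auto
  have ge: "0 \<le> ?L" by (intro le_Limsup always_eventually) (auto simp: max_periodic_radius_nonneg)
  from le ge obtain l where l: "?L = ereal l" by (cases ?L) auto
  then have l': "constrained_spectral_radius A T = l" by (simp add: constrained_spectral_radius_def)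
  show "?L = ereal (constrained_spectral_radius A T)" by (simp only: l l')
  show "0 \<le> constrained_spectral_radius A T" using ge unfolding l l' by simp
qed

lemma constrained_spectral_radius_le:
  "growth_bound (transition T) (\<lambda>i. complexify (A $ i)) s \<Longrightarrow> 0 < s \<Longrightarrow> constrained_spectral_radius A T \<le> s"
  using limsup_le_growth_bound[of T A s] by (simp add: limsup_eq_constrained_spectral_radius)

section \<open>Powers of periodic words and comparison with the growth rate\<close>

lemma periodic_power:
  fixes T :: "nat^'k^'k"
  assumes "w \<noteq> []" "admissible (transition T) (last w) w"
  shows "concat (replicate (Suc k) w) \<in> periodic_words T (Suc k * length w)"
proof -
  have "last (concat (replicate (Suc k) w)) = last w \<and> admissible (transition T) (last w) (concat (replicate (Suc k) w))"
  proof (induction k)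
    case (Suc k)
    then show ?case using assms by (simp add: admissible_append)
  qed (use assms in simp)
  then show ?thesis
    using assms(1) by (subst mem_periodic_words_iff) (auto simp: length_concat sum_list_replicate)
qed

lemma spectral_radius_power_le:
  "matrix_spectral_radius (word_product A w) ^ k \<le> matrix_spectral_radius (word_product A (concat (replicate k w)))"
proof -
  obtain \<mu> where \<mu>: "\<mu> \<in> eigenvalues (complexify (word_product A w))"
    "matrix_spectral_radius (word_product A w) = cmod \<mu>" by (rule spectral_radius_attained)
  then obtain v where v: "v \<noteq> 0" "cword (\<lambda>i. complexify (A $ i)) w *v v = \<mu> *s v"
    by (auto simp: eigenvalues_def complexify_word_product)
  have "cword (\<lambda>i. complexify (A $ i)) (concat (replicate k w)) *v v = \<mu> ^ k *s v"
    by (induction k)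
      (simp_all add: cword_append_apply v(2) vector_scalar_commute mult.commute del: cword.simps)
  then have "\<mu> ^ k \<in> eigenvalues (complexify (word_product A (concat (replicate k w))))"
    using v(1) by (auto simp: eigenvalues_def complexify_word_product)
  from eigenvalue_le_spectral_radius[OF this] show ?thesis by (simp add: \<mu>(2) norm_power)
qed

text \<open>Repetitions of \<open>w\<close> are periodic and their normalised radii do not drop
  below that of \<open>w\<close>. They occur along a subsequence of lengths, so the upper limit, and
  not merely the supremum, dominates each single word.\<close>

lemma constrained_spectral_radius_ge:
  fixes A :: "(real^'d^'d)^'k"
  assumes w: "w \<noteq> []" "admissible (transition T) (last w) w"
  shows "root (length w) (matrix_spectral_radius (word_product A w)) \<le> constrained_spectral_radius A T"
proof -
  let ?n = "length w" and ?m = "max_periodic_radius A T"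
  define y where "y = root ?n (matrix_spectral_radius (word_product A w))"
  have n: "0 < ?n" using w by simp
  have y: "0 \<le> y" "y ^ ?n = matrix_spectral_radius (word_product A w)"
    using n by (simp_all add: y_def spectral_radius_nonneg)
  define r where "r k = Suc k * ?n" for k
  have "y \<le> ?m (r k)" for k
  proof -
    have "y ^ r k = matrix_spectral_radius (word_product A w) ^ Suc k"
      unfolding r_def y(2)[symmetric] by (metis mult.commute power_mult)
    also have "\<dots> \<le> matrix_spectral_radius (word_product A (concat (replicate (Suc k) w)))"
      by (rule spectral_radius_power_le)
    finally have "root (r k) (y ^ r k) \<le> root (r k) (matrix_spectral_radius (word_product A (concat (replicate (Suc k) w))))"
      using n by (simp add: r_def)
    also have "\<dots> \<le> ?m (r k)"
      unfolding r_def by (intro max_periodic_radius_ge periodic_power w)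
    finally show ?thesis using n y(1) by (simp add: r_def real_root_power_cancel)
  qed
  then have "ereal y \<le> limsup ((\<lambda>n. ereal (?m n)) \<circ> r)"
    by (intro le_Limsup always_eventually) auto
  also have "\<dots> \<le> limsup (\<lambda>n. ereal (?m n))"
    using n by (intro limsup_subseq_mono) (auto simp: strict_mono_def r_def)
  finally show ?thesis by (simp add: limsup_eq_constrained_spectral_radius y_def)
qed

text \<open>The constrained radius dominates the normalised spectral radius of every periodic word,
  so Berger-Wang applies with it as \<theta>.\<close>

lemma growth_bound_of_constrained_spectral_radius:
  assumes "constrained_spectral_radius A T < s"
  shows "growth_bound (transition T) (\<lambda>i. complexify (A $ i)) s"
proof (rule growth_bound_of_periodic_eigenvalues[OF _ constrained_spectral_radius_nonneg assms])
  fix w \<mu> assume w: "w \<noteq> []" "admissible (transition T) (last w) w"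
    "\<mu> \<in> eigenvalues (cword (\<lambda>i. complexify (A $ i)) w)"
  have "cmod \<mu> \<le> matrix_spectral_radius (word_product A w)"
    using w(3) by (intro eigenvalue_le_spectral_radius) (simp add: complexify_word_product)
  also have "\<dots> = root (length w) (matrix_spectral_radius (word_product A w)) ^ length w"
    using w(1) by (simp add: spectral_radius_nonneg)
  also have "\<dots> \<le> constrained_spectral_radius A T ^ length w"
    using w by (intro power_mono constrained_spectral_radius_ge) (auto simp: real_root_ge_zero spectral_radius_nonneg)
  finally show "cmod \<mu> \<le> constrained_spectral_radius A T ^ length w" .
qed

lemma periodic_word_radius_gt:
  fixes A :: "(real^'d^'d)^'k"
  assumes "a < constrained_spectral_radius A T" "0 \<le> a"
  obtains w where "w \<noteq> []" "admissible (transition T) (last w) w"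
    "a < root (length w) (matrix_spectral_radius (word_product A w))"
proof -
  have "\<exists>n>0. a < max_periodic_radius A T n"
  proof (rule ccontr)
    assume "\<not> ?thesis"
    then have le: "max_periodic_radius A T n \<le> a" if "0 < n" for n
      using that by (meson not_less)
    have "\<forall>\<^sub>F n in sequentially. ereal (max_periodic_radius A T n) \<le> ereal a"
      by (rule eventually_mono[OF eventually_gt_at_top[of 0]]) (simp add: le)
    then have "limsup (\<lambda>n. ereal (max_periodic_radius A T n)) \<le> ereal a"
      by (rule Limsup_bounded)
    then show False using assms by (simp add: limsup_eq_constrained_spectral_radius)
  qed
  then obtain n where n: "0 < n" "a < max_periodic_radius A T n" by blast
  \<comment> \<open>A value above \<open>a\<close>, which is nonnegative, cannot be the default 0
    for an empty set of words.\<close>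
  have "periodic_words T n \<noteq> {}" using n(2) assms(2) by (auto simp: max_periodic_radius_def)
  then obtain w where w: "w \<in> periodic_words T n" "a < root n (matrix_spectral_radius (word_product A w))"
    using n(2) finite_periodic_words[of T n] by (auto simp: max_periodic_radius_def Max_gr_iff)
  from w(1) have len: "length w = n" by (simp add: periodic_words_def)
  then have ne: "w \<noteq> []" using n(1) by auto
  show ?thesis
  proof (rule that[OF ne])
    show "admissible (transition T) (last w) w" using w(1) by (simp add: mem_periodic_words_iff[OF ne])
    show "a < root (length w) (matrix_spectral_radius (word_product A w))" using w(2) by (simp add: len)
  qed
qed

theorem corollary1p5:
  fixes T :: "nat^'k^'k"
  assumes "CARD('k) \<ge> 2"
    and "\<forall>i j. T $ i $ j \<in> {0, 1}"
  shows "continuous_on UNIV (\<lambda>A :: (real^'d^'d)^'k. constrained_spectral_radius A T)"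
proof -
  have "((\<lambda>A. constrained_spectral_radius A T) \<longlongrightarrow> constrained_spectral_radius A0 T) (nhds A0)"
    for A0 :: "(real^'d^'d)^'k"
  proof (rule order_tendstoI)
    fix a assume a: "a < constrained_spectral_radius A0 T"
    show "\<forall>\<^sub>F A in nhds A0. a < constrained_spectral_radius A T"
    \<comment> \<open>The passage from roots to powers below requires a nonnegative
      \<open>a\<close>; negative values are covered by nonnegativity of the radius.\<close>
    proof (cases "a < 0")
      case True
      then show ?thesis by (intro always_eventually allI less_le_trans[OF _ constrained_spectral_radius_nonneg])
    next
      case False
      then have "0 \<le> a" by simp
      with a obtain w where w: "w \<noteq> []" "admissible (transition T) (last w) w"
        "a < root (length w) (matrix_spectral_radius (word_product A0 w))"
        by (rule periodic_word_radius_gt)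
      have root_gt: "a < root (length w) y \<longleftrightarrow> a ^ length w < y" for y
        using real_root_less_iff[of "length w" "a ^ length w" y] w(1) False
        by (simp add: real_root_power_cancel)
      have "\<forall>\<^sub>F A in nhds A0. a ^ length w < matrix_spectral_radius (word_product A w)"
        using w(3) by (intro eventually_spectral_radius_gt) (simp add: root_gt)
      then show ?thesis
      proof eventually_elim
        case (elim A)
        then have "a < root (length w) (matrix_spectral_radius (word_product A w))" by (simp only: root_gt)
        then show ?case using constrained_spectral_radius_ge[OF w(1,2)] by (rule less_le_trans)
      qed
    qed
  next
    fix a assume "constrained_spectral_radius A0 T < a"
    \<comment> \<open>Two intermediate rates: Berger-Wang gives the growth bound at
      \<open>p\<close>, the gap from \<open>p\<close> to \<open>q\<close> absorbs the perturbation,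
      and the gap from \<open>q\<close> to \<open>a\<close> makes the final inequality
      strict.\<close>
    then obtain q where q: "constrained_spectral_radius A0 T < q" "q < a" using dense by blast
    then obtain p where p: "constrained_spectral_radius A0 T < p" "p < q" using dense by blast
    have "0 < p" using constrained_spectral_radius_nonneg p(1) by (rule le_less_trans)
    have "\<forall>\<^sub>F A in nhds A0. growth_bound (transition T) (\<lambda>i. complexify (A $ i)) q"
      using growth_bound_of_constrained_spectral_radius[OF p(1)] \<open>0 < p\<close> p(2) by (rule eventually_growth_bound)
    then show "\<forall>\<^sub>F A in nhds A0. constrained_spectral_radius A T < a"
    proof eventually_elim
      case (elim A)
      then show ?case using constrained_spectral_radius_le[OF elim] q p \<open>0 < p\<close> by simp
    qed
  qed
  moreover have "at A0 \<le> nhds A0" for A0 :: "(real^'d^'d)^'k"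
    by (simp add: at_within_def)
  ultimately show ?thesis
    unfolding continuous_on_def by (blast intro: tendsto_mono)
qed

end
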